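(* Let $\Omega$ be a $\sigma$-compact metric space, $\nu$ a probability measure on the Borel $\sigma$-field of $\Omega$, $\mathcal{C}\in\mathbb{R}^{m\times m\times p}$ a symmetric T-product tensor, and $\tau\mapsto\mathcal{D}_\tau\in\mathbb{R}^{m\times m\times p}$ a continuous map from $\Omega$ into symmetric T-product tensors with $\sup_{\tau\in\Omega}\|\mathcal{D}_\tau\|<\infty$. Then the following are equivalent: (i) $\vec{\lambda}(\mathcal{C})\prec_w\int_{\Omega}\vec{\lambda}(\mathcal{D}_\tau)\,d\nu(\tau)$; (ii) for every non-decreasing convex function $f:\mathbb{R}\to[0,\infty)$ and every unitarily invariant norm $\|\cdot\|_\rho$, $$\|f(\mathcal{C})\|_\rho\le\int_\Omega\|f(\mathcal{D}_\tau)\|_\rho\,d\nu(\tau).$$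
   Context: T-product basics: for $\mathcal{C}\in\mathbb{C}^{m\times n\times p}$ with frontal slices $C^{(1)},\dots,C^{(p)}$, $\mathrm{bcirc}(\mathcal{C})$ is the $mp\times np$ block-circulant matrix with $(i,j)$ block $C^{(((i-j)\bmod p)+1)}$, $\mathrm{unfold}(\mathcal{C})$ stacks the slices vertically, $\mathrm{fold}=\mathrm{unfold}^{-1}$, and $\mathcal{C}\star\mathcal{D}=\mathrm{fold}(\mathrm{bcirc}(\mathcal{C})\mathrm{unfold}(\mathcal{D}))$. $\mathcal{C}^H=\mathrm{bcirc}^{-1}(\mathrm{bcirc}(\mathcal{C})^H)$, $\mathcal{C}^T=\mathrm{bcirc}^{-1}(\mathrm{bcirc}(\mathcal{C})^T)$; a real square tensor is symmetric if $\mathcal{C}^T=\mathcal{C}$. The identity $\mathcal{I}=\mathrm{bcirc}^{-1}(I_{mp})$. Every square $\mathcal{C}$ satisfies $\mathrm{bcirc}(\mathcal{C})=(F_p^H\otimes I_m)\mathrm{Diag}(C_1,\dots,C_p)(F_p\otimes I_m)$ with $F_p$ the normalized $p\times p$ DFT matrix; $C_1,\dots,C_p$ are the Fourier blocks (Hermitian if $\mathcal{C}$ is symmetric). The T-eigenvalues of a symmetric $\mathcal{C}$ are the $mp$ eigenvalues (with multiplicity) of $C_1,\dots,C_p$, listed as $\lambda_1(\mathcal{C})\ge\dots\ge\lambda_{mp}(\mathcal{C})$, and $\vec\lambda(\mathcal{C})=(\lambda_1(\mathcal{C}),\dots,\lambda_{mp}(\mathcal{C}))$; the T-singular values $\sigma_1(\mathcal{C})\ge\dots\ge\sigma_{mp}(\mathcal{C})$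 are the singular values of $C_1,\dots,C_p$ together. For a function $f$ on the T-eigenvalues, $f(\mathcal{C})$ is the tensor with $\mathrm{bcirc}(f(\mathcal{C}))=(F_p^H\otimes I_m)\mathrm{Diag}(f(C_1),\dots,f(C_p))(F_p\otimes I_m)$. $|\mathcal{H}|=(\mathcal{H}^H\star\mathcal{H})^{1/2}$. Unitarily invariant norms: for a symmetric gauge function $\rho$ on $\mathbb{R}^{mp}_{\ge 0}$ (restriction of a permutation-invariant absolute norm), $\|\mathcal{H}\|_\rho=\rho(\vec\lambda(|\mathcal{H}|))=\rho(\sigma_1(\mathcal{H}),\dots,\sigma_{mp}(\mathcal{H}))$; $\|\cdot\|$ denotes the operator norm $\sigma_1(\cdot)$. Majorization: for $x,y\in\mathbb{R}^r$ with decreasing rearrangements $x^\downarrow,y^\downarrow$, $x\prec_w y$ means $\sum_{i=1}^k x^\downarrow_i\le\sum_{i=1}^k y^\downarrow_i$ for all $k=1,\dots,r$. The vector $\int_\Omega\vec{\lambda}(\mathcal{D}_\tau)\,d\nu(\tau)$ means $\big(\int_\Omega\lambda_1(\mathcal{D}_\tau)d\nu,\dots,\int_\Omega\lambda_{mp}(\mathcal{D}_\tau)d\nu\big)$. *)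

theory Defs
  imports "Jordan_Normal_Form.Schur_Decomposition" "HOL-Probability.Probability"
begin

text \<open>A tensor in C^(m x n x p) is represented by its frontal slices:
  slice j (0-indexed, j < p) is an m x n matrix. Real tensors have real slices.\<close>

type_synonym rtensor = "nat \<Rightarrow> real mat"
type_synonym ctensor = "nat \<Rightarrow> complex mat"

definition is_tensor :: "nat \<Rightarrow> nat \<Rightarrow> nat \<Rightarrow> (nat \<Rightarrow> 'a mat) \<Rightarrow> bool" where
  "is_tensor m n p C \<longleftrightarrow> (\<forall>j<p. C j \<in> carrier_mat m n)"

definition cplx_tensor :: "rtensor \<Rightarrow> ctensor" where
  "cplx_tensor C = (\<lambda>j. map_mat complex_of_real (C j))"

text \<open>T-transpose: bcirc(C^T) = bcirc(C)^T, i.e. slice j of C^T is the transpose of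
  slice (-j mod p) of C.\<close>
definition t_transpose :: "nat \<Rightarrow> (nat \<Rightarrow> 'a mat) \<Rightarrow> (nat \<Rightarrow> 'a mat)" where
  "t_transpose p C = (\<lambda>j. transpose_mat (C ((p - j) mod p)))"

definition t_symmetric :: "nat \<Rightarrow> nat \<Rightarrow> rtensor \<Rightarrow> bool" where
  "t_symmetric m p C \<longleftrightarrow> is_tensor m m p C \<and> (\<forall>j<p. t_transpose p C j = C j)"

text \<open>Fourier blocks: bcirc(C) = (F_p^H (x) I) Diag(C_1..C_p) (F_p (x) I) with
  F_p the normalized DFT matrix, (F_p)_(a,b) = w^(ab)/sqrt p, w = exp(-2 pi i/p).
  Block k (0-indexed) is C_k = sum_j w^(jk) C^(j).\<close>
definition dft_root :: "nat \<Rightarrow> complex" where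
  "dft_root p = cis (- 2 * pi / real p)"

definition fourier_block :: "nat \<Rightarrow> nat \<Rightarrow> ctensor \<Rightarrow> nat \<Rightarrow> complex mat" where
  "fourier_block m p C k =
     Matrix.mat m m (\<lambda>(a, b). \<Sum>j<p. dft_root p ^ (j * k) * C j $$ (a, b))"

definition tensor_of_blocks :: "nat \<Rightarrow> nat \<Rightarrow> (nat \<Rightarrow> complex mat) \<Rightarrow> ctensor" where
  "tensor_of_blocks m p B =
     (\<lambda>j. Matrix.mat m m (\<lambda>(a, b). (\<Sum>k<p. cnj (dft_root p) ^ (j * k) * B k $$ (a, b)) / of_nat p))"

definition unitary_mat :: "nat \<Rightarrow> complex mat \<Rightarrow> bool" where
  "unitary_mat n U \<longleftrightarrow> U \<in> carrier_mat n n \<and> mat_adjoint U * U = 1\<^sub>m n"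

definition diag_of_list :: "complex list \<Rightarrow> complex mat" where
  "diag_of_list xs = Matrix.mat (length xs) (length xs) (\<lambda>(i, j). if i = j then xs ! i else 0)"

definition mat_fun :: "(real \<Rightarrow> real) \<Rightarrow> complex mat \<Rightarrow> complex mat" where
  "mat_fun f A = (SOME B. \<exists>U ev. unitary_mat (dim_row A) U \<and> length ev = dim_row A \<and>
      A = U * diag_of_list (map complex_of_real ev) * mat_adjoint U \<and>
      B = U * diag_of_list (map (complex_of_real \<circ> f) ev) * mat_adjoint U)"

definition herm_eigvals :: "complex mat \<Rightarrow> real list" where
  "herm_eigvals A = rev (sorted_list_of_multiset (image_mset Re (proots (char_poly A))))"

definition sing_vals :: "complex mat \<Rightarrow> real list" where
  "sing_vals A = rev (sorted_list_of_multiset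
      (image_mset (\<lambda>z. sqrt (Re z)) (proots (char_poly (mat_adjoint A * A)))))"

definition t_eigvals :: "nat \<Rightarrow> nat \<Rightarrow> rtensor \<Rightarrow> real list" where
  "t_eigvals m p C = rev (sort (concat
      (map (\<lambda>k. herm_eigvals (fourier_block m p (cplx_tensor C) k)) [0..<p])))"

definition t_singvals :: "nat \<Rightarrow> nat \<Rightarrow> ctensor \<Rightarrow> real list" where
  "t_singvals m p C = rev (sort (concat
      (map (\<lambda>k. sing_vals (fourier_block m p C k)) [0..<p])))"

definition t_opnorm :: "nat \<Rightarrow> nat \<Rightarrow> ctensor \<Rightarrow> real" where
  "t_opnorm m p C = hd (t_singvals m p C)"

text \<open>f(C): bcirc(f(C)) = (F^H (x) I) Diag(f(C_1),...,f(C_p)) (F (x) I).\<close>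
definition t_fun :: "nat \<Rightarrow> nat \<Rightarrow> (real \<Rightarrow> real) \<Rightarrow> rtensor \<Rightarrow> ctensor" where
  "t_fun m p f C = tensor_of_blocks m p
      (\<lambda>k. mat_fun f (fourier_block m p (cplx_tensor C) k))"

definition sym_gauge :: "nat \<Rightarrow> (real list \<Rightarrow> real) \<Rightarrow> bool" where
  "sym_gauge n \<rho> \<longleftrightarrow>
     (\<forall>x. length x = n \<longrightarrow> \<rho> x \<ge> 0 \<and> (\<rho> x = 0 \<longleftrightarrow> x = replicate n 0)) \<and>
     (\<forall>x c. length x = n \<longrightarrow> \<rho> (map (\<lambda>t. c * t) x) = \<bar>c\<bar> * \<rho> x) \<and>
     (\<forall>x y. length x = n \<longrightarrow> length y = n \<longrightarrow> \<rho> (map2 (+) x y) \<le> \<rho> x + \<rho> y) \<and>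
     (\<forall>x y. length x = n \<longrightarrow> mset x = mset y \<longrightarrow> \<rho> y = \<rho> x) \<and>
     (\<forall>x. length x = n \<longrightarrow> \<rho> (map abs x) = \<rho> x)"

definition t_ui_norm :: "nat \<Rightarrow> nat \<Rightarrow> (real list \<Rightarrow> real) \<Rightarrow> ctensor \<Rightarrow> real" where
  "t_ui_norm m p \<rho> H = \<rho> (t_singvals m p H)"

definition weak_submaj :: "real list \<Rightarrow> real list \<Rightarrow> bool" where
  "weak_submaj x y \<longleftrightarrow> length x = length y \<and>
     (\<forall>k\<in>{1..length x}. sum_list (take k (rev (sort x))) \<le> sum_list (take k (rev (sort y))))"

definition sigma_compact :: "'a::topological_space set \<Rightarrow> bool" where
  "sigma_compact S \<longleftrightarrow> (\<exists>K :: nat \<Rightarrow> 'a set. (\<forall>n. compact (K n)) \<and> (\<Union>n. K n) = S)"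

end

theory Submission
  imports Defs
begin

text \<open>
  (i) implies (ii): let \<open>x\<^sub>i\<close> be the ordered eigenvalues of \<open>C\<close>, \<open>Y\<^sub>i\<close> those of \<open>D\<close>, and \<open>s\<close> a subgradient
  of \<open>f\<close>. Integrating \<open>f Y\<^sub>i \<ge> f x\<^sub>i + s x\<^sub>i * (Y\<^sub>i - x\<^sub>i)\<close> and summing by parts (the weights \<open>s x\<^sub>i\<close> are
  nonnegative and decreasing) shows that the partial sums of \<open>f x\<^sub>i\<close> are dominated by those of
  \<open>\<integral> f Y\<^sub>i\<close>. A symmetric gauge respects this domination, and it satisfies Jensen's inequality.
  (ii) implies (i): apply (ii) to the Ky Fan norms and to \<open>f t = max (t + c) 0\<close> with large \<open>c\<close>.

  The eigenvalues of \<open>D\<close> are measurable because their power sums are traces of powers of the Fourier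
  blocks: polynomials in the eigenvalues approximate the number of eigenvalues above a level.
\<close>

unbundle no vec_syntax

section \<open>The spectral theorem for Hermitian matrices\<close>

text \<open>Everything about tensors is reduced to real vectors of length \<open>m * p\<close>: as a
  multiset, the singular values of \<open>f(C)\<close> are the image of the T-eigenvalues under
  \<open>|f|\<close>, and a gauge sees only that multiset. For the same reason the choice inside
  \<open>mat_fun\<close> is harmless. Bochner integrals of non-integrable functions are 0 by
  convention, so integrability must be secured before integrals are compared; the uniform bound on
  \<open>t_opnorm\<close> confines all eigenvalues of \<open>D\<close> to one interval, and
  boundedness plus measurability suffices. Working with symmetric functions of the eigenvalues
  avoids perturbation theory for individual ordered eigenvalues. Monotonicity of \<open>f\<close>
  keeps its values on the ordered eigenvalues decreasing, makes the subgradients nonnegative, and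
  makes its values on the eigenvalues of \<open>D\<close> bounded and measurable. The shift in the
  converse reconciles \<open>f \<ge> 0\<close> with negative eigenvalues.\<close>

lemma mat_adjoint_dim [simp]:
  "dim_row (mat_adjoint A) = dim_col A" "dim_col (mat_adjoint A) = dim_row A"
  by (simp_all add: mat_adjoint_def)

lemma mat_adjoint_index [simp]:
  "i < dim_col A \<Longrightarrow> j < dim_row A \<Longrightarrow> mat_adjoint (A :: complex mat) $$ (i, j) = cnj (A $$ (j, i))"
  by (simp add: mat_adjoint_def mat_of_rows_index)

lemma mat_adjoint_carrier [simp, intro]:
  "A \<in> carrier_mat m n \<Longrightarrow> mat_adjoint A \<in> carrier_mat n m"
  by auto

lemma mat_adjoint_mat_adjoint [simp]: "mat_adjoint (mat_adjoint (A :: complex mat)) = A"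
  by (rule eq_matI) auto

lemma mat_adjoint_mult:
  assumes "A \<in> carrier_mat l m" "B \<in> carrier_mat m n"
  shows "mat_adjoint (A * B :: complex mat) = mat_adjoint B * mat_adjoint A"
  by (rule eq_matI) (use assms in \<open>auto simp: scalar_prod_def mult.commute\<close>)

lemma mat_adjoint_four_block:
  assumes "A \<in> carrier_mat a a" "D \<in> carrier_mat d d"
  shows "mat_adjoint (four_block_mat A (0\<^sub>m a d) (0\<^sub>m d a) D :: complex mat) =
    four_block_mat (mat_adjoint A) (0\<^sub>m a d) (0\<^sub>m d a) (mat_adjoint D)"
  by (rule eq_matI) (use assms in auto)

lemma unitary_mat_mult:
  assumes "unitary_mat n U" "unitary_mat n V"
  shows "unitary_mat n (U * V)"
proof -
  have U: "U \<in> carrier_mat n n" "mat_adjoint U * U = 1\<^sub>m n"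
    and V: "V \<in> carrier_mat n n" "mat_adjoint V * V = 1\<^sub>m n"
    using assms by (auto simp: unitary_mat_def)
  have "mat_adjoint (U * V) * (U * V) = (mat_adjoint V * mat_adjoint U) * (U * V)"
    using U V by (simp add: mat_adjoint_mult)
  also have "\<dots> = mat_adjoint V * ((mat_adjoint U * U) * V)"
    using U(1) V(1) by (simp add: assoc_mult_mat[of _ n n _ n _ n])
  finally show ?thesis using U V by (simp add: unitary_mat_def)
qed

lemma unitary_mat_right_inverse:
  assumes "unitary_mat n U"
  shows "U * mat_adjoint U = 1\<^sub>m n"
  using assms mat_mult_left_right_inverse[of "mat_adjoint U" n U] by (auto simp: unitary_mat_def)

text \<open>Gram-Schmidt keeps the first vector of a basis completing \<open>v\<close> and yields an
  orthogonal list that is not normalised; dividing by the lengths \<open>sqrt (q j)\<close> makes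
  the columns orthonormal and leaves column 0 a multiple of \<open>v\<close>.\<close>

lemma exists_unitary_with_first_col:
  fixes v :: "complex Matrix.vec"
  assumes v: "v \<in> carrier_vec n" "v \<noteq> 0\<^sub>v n"
  shows "\<exists>W c. unitary_mat n W \<and> col W 0 = c \<cdot>\<^sub>v v"
proof -
  interpret cof_vec_space n "TYPE(complex)" .
  define b where "b = basis_completion v"
  define ws where "ws = gram_schmidt n b"
  have n: "n \<noteq> 0" using v by auto
  from basis_completion[OF v, folded b_def]
  have dist_b: "distinct b" and indep: "\<not> lin_dep (set b)" and b: "set b \<subseteq> carrier_vec n"
    and hdb: "hd b = v" and len_b: "length b = n" by auto
  from hdb len_b n obtain vs where bv: "b = v # vs" by (cases b, auto)
  from gram_schmidt_result[OF b dist_b indep refl, folded ws_def]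
  have ws: "set ws \<subseteq> carrier_vec n" "corthogonal ws" "length ws = n"
    by (auto simp: len_b)
  from gram_schmidt_hd[OF v(1), of vs, folded bv] have "hd ws = v" unfolding ws_def .
  with ws n have ws0: "ws ! 0 = v" by (metis hd_conv_nth length_0_conv)
  define q where "q j = (\<Sum>k<n. (cmod (ws ! j $ k))\<^sup>2)" for j
  define W where "W = Matrix.mat n n (\<lambda>(k, j). ws ! j $ k / complex_of_real (sqrt (q j)))"
  have car: "ws ! j \<in> carrier_vec n" if "j < n" for j using ws that by auto
  have sp: "ws ! j \<bullet>c ws ! i = (\<Sum>k<n. cnj (ws ! i $ k) * ws ! j $ k)" if "i < n" "j < n" for i j
    using car[OF that(1)] car[OF that(2)]
    by (auto simp: scalar_prod_def mult.commute lessThan_atLeast0 intro!: sum.cong)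
  have q: "complex_of_real (q j) = ws ! j \<bullet>c ws ! j" if "j < n" for j
    by (subst sp[OF that that]) (simp only: q_def of_real_sum complex_norm_square mult.commute)
  have q0: "q j > 0" if "j < n" for j
  proof -
    have "q j \<noteq> 0" using q[OF that] corthogonalD[OF ws(2), of j j] that ws(3) by auto
    moreover have "q j \<ge> 0" unfolding q_def by (intro sum_nonneg) auto
    ultimately show ?thesis by linarith
  qed
  have "mat_adjoint W * W = 1\<^sub>m n"
  proof (rule eq_matI)
    fix i j assume ij: "i < dim_row (1\<^sub>m n :: complex mat)" "j < dim_col (1\<^sub>m n :: complex mat)"
    hence i: "i < n" and j: "j < n" by auto
    have "(mat_adjoint W * W) $$ (i, j) = (\<Sum>k<n. cnj (W $$ (k, i)) * W $$ (k, j))"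
      using i j by (auto simp: W_def scalar_prod_def lessThan_atLeast0 intro!: sum.cong)
    also have "\<dots> = (\<Sum>k<n. (cnj (ws ! i $ k) * ws ! j $ k) / complex_of_real (sqrt (q i) * sqrt (q j)))"
      using i j by (intro sum.cong) (auto simp: W_def)
    also have "\<dots> = (ws ! j \<bullet>c ws ! i) / complex_of_real (sqrt (q i) * sqrt (q j))"
      unfolding sp[OF i j] sum_divide_distrib ..
    also have "\<dots> = (if i = j then 1 else 0)"
    proof (cases "i = j")
      case True
      have s: "sqrt (q j) * sqrt (q j) = q j" using q0[OF j] by simp
      have "ws ! j \<bullet>c ws ! j / complex_of_real (sqrt (q j) * sqrt (q j)) = 1"
        unfolding s q[OF j, symmetric] using q0[OF j] by simp
      thus ?thesis using True by simp
    next
      case False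
      thus ?thesis using corthogonalD[OF ws(2), of j i] i j ws(3) by auto
    qed
    finally show "(mat_adjoint W * W) $$ (i, j) = 1\<^sub>m n $$ (i, j)" using i j by simp
  qed (auto simp: W_def)
  moreover have "col W 0 = (1 / complex_of_real (sqrt (q 0))) \<cdot>\<^sub>v v"
    by (rule eq_vecI) (use n v ws0 in \<open>auto simp: W_def\<close>)
  moreover have "W \<in> carrier_mat n n" by (simp add: W_def)
  ultimately show ?thesis unfolding unitary_mat_def by blast
qed

lemma diag_of_list_carrier [simp]: "length xs = n \<Longrightarrow> diag_of_list xs \<in> carrier_mat n n"
  by (auto simp: diag_of_list_def)

lemma diag_of_list_Cons:
  "diag_of_list (x # xs) = four_block_mat (Matrix.mat 1 1 (\<lambda>_. x)) (0\<^sub>m 1 (length xs))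
     (0\<^sub>m (length xs) 1) (diag_of_list xs)"
  by (rule eq_matI) (auto simp: diag_of_list_def nth_Cons' less_Suc_eq_0_disj)

text \<open>Induction by deflation: in an orthonormal basis that starts with an eigenvector, the
  first column is \<open>e\<close> times a unit vector. Hermitian symmetry then clears the first
  row, forces \<open>e\<close> to be real, and passes to the lower right block.\<close>

theorem hermitian_spectral:
  fixes A :: "complex mat"
  assumes "A \<in> carrier_mat n n" "mat_adjoint A = A"
  shows "\<exists>U es. unitary_mat n U \<and> length es = n \<and>
    A = U * diag_of_list (map complex_of_real es) * mat_adjoint U"
  using assms
proof (induction n arbitrary: A)
  case 0
  thus ?case by (intro exI[of _ "1\<^sub>m 0"] exI[of _ "[]"]) (auto simp: unitary_mat_def diag_of_list_def)
next
  case (Suc n A)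
  let ?N = "Suc n"
  from char_poly_factorized[OF Suc.prems(1)] obtain as
    where as: "char_poly A = (\<Prod>a\<leftarrow>as. [:- a, 1:])" "length as = ?N" by auto
  then obtain e as' where "as = e # as'" by (cases as) auto
  with as(1) have "poly (char_poly A) e = 0" by simp
  hence "eigenvalue A e" using eigenvalue_root_char_poly[OF Suc.prems(1)] by simp
  then obtain v where v: "v \<in> carrier_vec ?N" "v \<noteq> 0\<^sub>v ?N" "A *\<^sub>v v = e \<cdot>\<^sub>v v"
    using Suc.prems(1) unfolding eigenvalue_def eigenvector_def by auto
  obtain W c where W: "unitary_mat ?N W" and col0: "col W 0 = c \<cdot>\<^sub>v v"
    using exists_unitary_with_first_col[OF v(1,2)] by blast
  have Wc: "W \<in> carrier_mat ?N ?N" and W1: "mat_adjoint W * W = 1\<^sub>m ?N"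
    using W by (auto simp: unitary_mat_def)
  have W2: "W * mat_adjoint W = 1\<^sub>m ?N" by (rule unitary_mat_right_inverse[OF W])
  define A' where "A' = mat_adjoint W * (A * W)"
  have A'c: "A' \<in> carrier_mat ?N ?N" unfolding A'_def using Suc.prems Wc by auto
  have herm: "mat_adjoint A' = A'"
    unfolding A'_def using Suc.prems Wc
    by (simp add: mat_adjoint_mult[of _ ?N ?N _ ?N] assoc_mult_mat[of _ ?N ?N _ ?N _ ?N])
  have hermi: "A' $$ (i, j) = cnj (A' $$ (j, i))" if "i < ?N" "j < ?N" for i j
    using herm mat_adjoint_index[of i A' j] A'c that by simp
  have "col A' 0 = mat_adjoint W *\<^sub>v col (A * W) 0"
    unfolding A'_def using Suc.prems(1) Wc by (intro col_mult2[of _ ?N ?N _ ?N]) simp_all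
  also have "col (A * W) 0 = A *\<^sub>v col W 0"
    using Suc.prems(1) Wc by (intro col_mult2[of _ ?N ?N _ ?N]) simp_all
  also have "A *\<^sub>v col W 0 = e \<cdot>\<^sub>v col W 0"
    unfolding col0 using Suc.prems(1) v
    by (subst mult_mat_vec[of _ ?N ?N]) (auto simp: smult_smult_assoc mult.commute)
  also have "mat_adjoint W *\<^sub>v (e \<cdot>\<^sub>v col W 0) = e \<cdot>\<^sub>v col (mat_adjoint W * W) 0"
    using Wc by (subst mult_mat_vec[of _ ?N ?N]) (auto simp: col_carrier_vec[of 0 ?N])
  finally have c0: "col A' 0 = e \<cdot>\<^sub>v unit_vec ?N 0" using W1 by simp
  have A'0: "A' $$ (i, 0) = (if i = 0 then e else 0)" if "i < ?N" for i
    using arg_cong[OF c0, of "\<lambda>v. v $ i"] that A'c by (auto simp: unit_vec_def)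
  have ereal: "e = complex_of_real (Re e)"
    using hermi[of 0 0] A'0[of 0] by (simp add: complex_eq_iff)
  define A3 where "A3 = Matrix.mat n n (\<lambda>(i, j). A' $$ (Suc i, Suc j))"
  have A3: "A3 \<in> carrier_mat n n" by (simp add: A3_def)
  have "mat_adjoint A3 = A3"
    by (rule eq_matI) (auto simp: A3_def hermi[symmetric])
  from Suc.IH[OF A3 this] obtain U3 es where U3: "unitary_mat n U3" and len: "length es = n"
    and A3eq: "A3 = U3 * diag_of_list (map complex_of_real es) * mat_adjoint U3" by blast
  have U3c: "U3 \<in> carrier_mat n n" and U31: "mat_adjoint U3 * U3 = 1\<^sub>m n"
    using U3 by (auto simp: unitary_mat_def)
  let ?E = "Matrix.mat 1 1 (\<lambda>_. e)"
  let ?D3 = "diag_of_list (map complex_of_real es)"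
  let ?D = "diag_of_list (map complex_of_real (Re e # es))"
  have D3: "?D3 \<in> carrier_mat n n" using len by simp
  have D: "?D = four_block_mat ?E (0\<^sub>m 1 n) (0\<^sub>m n 1) ?D3"
    using diag_of_list_Cons[of e "map complex_of_real es"] len ereal by simp
  have A'eq: "A' = four_block_mat ?E (0\<^sub>m 1 n) (0\<^sub>m n 1) A3"
  proof (rule eq_matI)
    fix i j assume "i < dim_row (four_block_mat ?E (0\<^sub>m 1 n) (0\<^sub>m n 1) A3)"
      "j < dim_col (four_block_mat ?E (0\<^sub>m 1 n) (0\<^sub>m n 1) A3)"
    hence i: "i < ?N" and j: "j < ?N" using A3 by auto
    show "A' $$ (i, j) = four_block_mat ?E (0\<^sub>m 1 n) (0\<^sub>m n 1) A3 $$ (i, j)"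
      using i j A'0[OF i] A'0[OF j] hermi[OF i j] A3 by (cases i; cases j) (auto simp: A3_def)
  qed (use A'c A3 in auto)
  \<comment> \<open>\<open>V\<close> extends the unitary of the smaller block by a 1 in the corner,
    so that \<open>W * V\<close> diagonalises \<open>A\<close>.\<close>
  define V where "V = four_block_mat (1\<^sub>m 1) (0\<^sub>m 1 n) (0\<^sub>m n 1) U3"
  have Vc: "V \<in> carrier_mat ?N ?N" using U3c unfolding V_def by auto
  have Va: "mat_adjoint V = four_block_mat (1\<^sub>m 1) (0\<^sub>m 1 n) (0\<^sub>m n 1) (mat_adjoint U3)"
    unfolding V_def using U3c by (subst mat_adjoint_four_block) auto
  have four: "four_block_mat P (0\<^sub>m 1 n) (0\<^sub>m n 1) Q * four_block_mat P' (0\<^sub>m 1 n) (0\<^sub>m n 1) Q'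
    = four_block_mat (P * P') (0\<^sub>m 1 n) (0\<^sub>m n 1) (Q * Q')"
    if "P \<in> carrier_mat 1 1" "P' \<in> carrier_mat 1 1" "Q \<in> carrier_mat n n" "Q' \<in> carrier_mat n n"
    for P P' Q Q' :: "complex mat"
    using that by (subst mult_four_block_mat[of _ 1 1 _ n _ n _ _ 1 _ n]) auto
  have "mat_adjoint V * V = four_block_mat (1\<^sub>m 1) (0\<^sub>m 1 n) (0\<^sub>m n 1) (1\<^sub>m n)"
    unfolding Va by (subst V_def, subst four) (use U3c U31 in auto)
  also have "\<dots> = 1\<^sub>m ?N" by (rule eq_matI) auto
  finally have V: "unitary_mat ?N V" using Vc by (simp add: unitary_mat_def)
  have VD: "V * ?D * mat_adjoint V = A'"
  proof -
    have Ec: "?E \<in> carrier_mat 1 1" by simp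
    have "V * ?D = four_block_mat ?E (0\<^sub>m 1 n) (0\<^sub>m n 1) (U3 * ?D3)"
      unfolding V_def D using four[OF _ Ec U3c D3, of "1\<^sub>m 1"] Ec by simp
    also have "\<dots> * mat_adjoint V = four_block_mat ?E (0\<^sub>m 1 n) (0\<^sub>m n 1) (U3 * ?D3 * mat_adjoint U3)"
      unfolding Va using four[OF Ec _ _ mat_adjoint_carrier[OF U3c], of "1\<^sub>m 1" "U3 * ?D3"] Ec U3c D3
      by simp
    finally show ?thesis unfolding A'eq A3eq .
  qed
  have Dc: "?D \<in> carrier_mat ?N ?N" using len by simp
  have "W * V * X * mat_adjoint (W * V) = W * (V * X * mat_adjoint V) * mat_adjoint W"
    if "X \<in> carrier_mat ?N ?N" for X
    using Wc Vc that by (simp add: mat_adjoint_mult[of _ ?N ?N _ ?N] assoc_mult_mat[of _ ?N ?N _ ?N _ ?N]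
      mult_carrier_mat[of _ ?N ?N _ ?N])
  from this[OF Dc]
  have "W * V * ?D * mat_adjoint (W * V) = W * (V * ?D * mat_adjoint V) * mat_adjoint W" .
  also have "\<dots> = (W * mat_adjoint W) * A * (W * mat_adjoint W)"
    unfolding VD A'_def using Wc Suc.prems(1)
    by (simp add: assoc_mult_mat[of _ ?N ?N _ ?N _ ?N] mult_carrier_mat[of _ ?N ?N _ ?N])
  also have "\<dots> = A" unfolding W2 using Suc.prems(1) by simp
  finally show ?case using unitary_mat_mult[OF W V] len
    by (intro exI[of _ "W * V"] exI[of _ "Re e # es"]) simp
qed

section \<open>Spectra, singular values and traces of unitarily diagonalised matrices\<close>

lemma unitary_diag_similar:
  assumes "unitary_mat n U" "length xs = n"
  shows "similar_mat_wit (U * diag_of_list xs * mat_adjoint U) (diag_of_list xs) U (mat_adjoint U)"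
  using assms unitary_mat_right_inverse[OF assms(1)]
  by (intro similar_mat_witI[of _ _ n]) (auto simp: unitary_mat_def)

lemma sum_list_singleton_mset: "(\<Sum>x\<leftarrow>xs. {#x#}) = mset xs"
  by (induction xs) auto

text \<open>Similar matrices share the characteristic polynomial, and that of a diagonal matrix is a
  product of linear factors. Hence the multiset of diagonal entries does not depend on the
  diagonalisation.\<close>

lemma proots_unitary_diag:
  assumes "unitary_mat n U" "length xs = n"
  shows "proots (char_poly (U * diag_of_list xs * mat_adjoint U)) = mset xs"
proof -
  have "char_poly (U * diag_of_list xs * mat_adjoint U) = char_poly (diag_of_list xs)"
    using unitary_diag_similar[OF assms] by (intro char_poly_similar) (auto simp: similar_mat_def)
  also have "\<dots> = (\<Prod>a\<leftarrow>diag_mat (diag_of_list xs). [:- a, 1:])"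
    by (rule char_poly_upper_triangular[of _ n]) (use assms(2) in \<open>auto simp: diag_of_list_def\<close>)
  also have "diag_mat (diag_of_list xs) = xs"
    by (rule nth_equalityI) (auto simp: diag_of_list_def diag_mat_def)
  also have "proots (\<Prod>a\<leftarrow>xs. [:- a, 1:]) = mset xs"
  proof -
    have "(0 :: complex poly) \<notin> set (map (\<lambda>a. [:- a, 1:]) xs)"
    proof
      assume "(0 :: complex poly) \<in> set (map (\<lambda>a. [:- a, 1:]) xs)"
      then obtain a where "(0 :: complex poly) = [:- a, 1:]" unfolding set_map by blast
      from arg_cong[OF this, of degree] show False by simp
    qed
    from proots_prod_list[OF this] show ?thesis by (simp add: comp_def sum_list_singleton_mset)
  qed
  finally show ?thesis .
qed

lemma mset_herm_eigvals_unitary_diag: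
  assumes "unitary_mat n U" "length es = n"
  shows "mset (herm_eigvals (U * diag_of_list (map complex_of_real es) * mat_adjoint U)) = mset es"
  using proots_unitary_diag[OF assms(1), of "map complex_of_real es"] assms(2)
  by (simp add: herm_eigvals_def multiset.map_comp comp_def)

lemma diag_of_list_mult_map:
  "diag_of_list (map f es) * diag_of_list (map g es) = diag_of_list (map (\<lambda>x. f x * g x) es)"
proof (rule eq_matI)
  fix i j assume "i < dim_row (diag_of_list (map (\<lambda>x. f x * g x) es))"
    "j < dim_col (diag_of_list (map (\<lambda>x. f x * g x) es))"
  hence ij: "i < length es" "j < length es" by (auto simp: diag_of_list_def)
  have "(diag_of_list (map f es) * diag_of_list (map g es)) $$ (i, j) =
    (\<Sum>k<length es. diag_of_list (map f es) $$ (i, k) * diag_of_list (map g es) $$ (k, j))"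
    using ij by (simp add: diag_of_list_def scalar_prod_def lessThan_atLeast0)
  also have "\<dots> = (\<Sum>k<length es. if i = k then f (es ! i) * (if k = j then g (es ! k) else 0) else 0)"
    using ij by (intro sum.cong) (auto simp: diag_of_list_def)
  finally have "(diag_of_list (map f es) * diag_of_list (map g es)) $$ (i, j) =
    (\<Sum>k<length es. if i = k then f (es ! i) * (if k = j then g (es ! k) else 0) else 0)" .
  thus "(diag_of_list (map f es) * diag_of_list (map g es)) $$ (i, j) =
    diag_of_list (map (\<lambda>x. f x * g x) es) $$ (i, j)"
    using ij by (simp add: diag_of_list_def)
qed (auto simp: diag_of_list_def)

text \<open>\<open>A^H A\<close> is diagonalised by the same \<open>U\<close> with squared entries,
  and the root of a square is the absolute value.\<close>

lemma mset_sing_vals_unitary_diag: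
  assumes U: "unitary_mat n U" and len: "length es = n"
  shows "mset (sing_vals (U * diag_of_list (map complex_of_real es) * mat_adjoint U)) = mset (map abs es)"
proof -
  let ?D = "diag_of_list (map complex_of_real es)" and ?D2 = "diag_of_list (map (\<lambda>x. complex_of_real x * complex_of_real x) es)"
  let ?A = "U * ?D * mat_adjoint U"
  have Uc: "U \<in> carrier_mat n n" and U1: "mat_adjoint U * U = 1\<^sub>m n"
    using U by (auto simp: unitary_mat_def)
  have D: "?D \<in> carrier_mat n n" "?D2 \<in> carrier_mat n n" using len by auto
  have adjD: "mat_adjoint ?D = ?D" by (rule eq_matI) (auto simp: diag_of_list_def)
  have "mat_adjoint ?A * ?A = U * (?D * ((mat_adjoint U * U) * (?D * mat_adjoint U)))"
    using Uc D adjD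
    by (simp add: mat_adjoint_mult[of _ n n _ n] assoc_mult_mat[of _ n n _ n _ n])
  also have "\<dots> = U * (?D * ?D) * mat_adjoint U"
    unfolding U1 using Uc D by (simp add: assoc_mult_mat[of _ n n _ n _ n])
  also have "?D * ?D = ?D2" by (rule diag_of_list_mult_map)
  finally have "proots (char_poly (mat_adjoint ?A * ?A)) = mset (map (\<lambda>x. complex_of_real x * complex_of_real x) es)"
    using proots_unitary_diag[OF U] len by simp
  thus ?thesis
    by (simp add: sing_vals_def multiset.map_comp comp_def real_sqrt_abs2)
qed

definition mat_trace :: "'a :: comm_ring_1 mat \<Rightarrow> 'a" where
  "mat_trace A = (\<Sum>i<dim_row A. A $$ (i, i))"

lemma trace_mult_commute:
  assumes "A \<in> carrier_mat n n" "B \<in> carrier_mat n n"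
  shows "mat_trace (A * B) = mat_trace (B * A)"
proof -
  have "mat_trace (A * B) = (\<Sum>i<n. \<Sum>j<n. A $$ (i, j) * B $$ (j, i))"
    using assms by (auto simp: mat_trace_def scalar_prod_def lessThan_atLeast0 intro!: sum.cong)
  also have "\<dots> = (\<Sum>j<n. \<Sum>i<n. B $$ (j, i) * A $$ (i, j))"
    by (subst sum.swap) (simp add: mult.commute)
  also have "\<dots> = mat_trace (B * A)"
    using assms by (auto simp: mat_trace_def scalar_prod_def lessThan_atLeast0 intro!: sum.cong)
  finally show ?thesis .
qed

text \<open>By cyclicity of the trace the conjugation by \<open>U\<close> drops out, which leaves
  the trace of a power of the diagonal matrix.\<close>

lemma trace_pow_unitary_diag:
  assumes U: "unitary_mat n U" and len: "length es = n"
  shows "mat_trace ((U * diag_of_list (map complex_of_real es) * mat_adjoint U) ^\<^sub>m k) =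
    complex_of_real (\<Sum>x\<leftarrow>es. x ^ k)"
proof -
  let ?D = "diag_of_list (map complex_of_real es)"
  have Uc: "U \<in> carrier_mat n n" and U1: "mat_adjoint U * U = 1\<^sub>m n"
    using U by (auto simp: unitary_mat_def)
  have Dk: "?D ^\<^sub>m k = diag_of_list (map (\<lambda>x. complex_of_real (x ^ k)) es)"
  proof (induction k)
    case 0
    show ?case by (rule eq_matI) (auto simp: diag_of_list_def)
  next
    case (Suc k)
    thus ?case by (simp add: diag_of_list_mult_map mult.commute)
  qed
  have Dkc: "?D ^\<^sub>m k \<in> carrier_mat n n" using len by simp
  have "(U * ?D * mat_adjoint U) ^\<^sub>m k = U * (?D ^\<^sub>m k * mat_adjoint U)"
    using similar_mat_wit_pow_id[OF unitary_diag_similar[OF U], of "map complex_of_real es" k] len Uc Dkc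
    by (simp add: assoc_mult_mat[of _ n n _ n _ n])
  also have "mat_trace \<dots> = mat_trace (?D ^\<^sub>m k * mat_adjoint U * U)"
    using Uc Dkc by (intro trace_mult_commute[of _ n]) auto
  also have "?D ^\<^sub>m k * mat_adjoint U * U = ?D ^\<^sub>m k"
    using Uc Dkc U1 by (simp add: assoc_mult_mat[of _ n n _ n _ n] right_mult_one_mat[OF Dkc])
  also have "mat_trace \<dots> = complex_of_real (\<Sum>x\<leftarrow>es. x ^ k)"
    unfolding Dk by (simp add: mat_trace_def diag_of_list_def sum_list_sum_nth lessThan_atLeast0)
  finally show ?thesis .
qed

text \<open>\<open>mat_fun\<close> selects by choice, so all that can be extracted is some pair
  \<open>U\<close>, \<open>es\<close> that diagonalises \<open>A\<close> and
  \<open>mat_fun f A\<close> together. The spectral theorem shows that the choice has a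
  candidate.\<close>

lemma mat_fun_hermitian:
  assumes "A \<in> carrier_mat n n" "mat_adjoint A = A"
  shows "\<exists>U es. unitary_mat n U \<and> length es = n \<and>
    A = U * diag_of_list (map complex_of_real es) * mat_adjoint U \<and>
    mat_fun f A = U * diag_of_list (map complex_of_real (map f es)) * mat_adjoint U"
proof -
  let ?P = "\<lambda>B. \<exists>U es. unitary_mat (dim_row A) U \<and> length es = dim_row A \<and>
      A = U * diag_of_list (map complex_of_real es) * mat_adjoint U \<and>
      B = U * diag_of_list (map (complex_of_real \<circ> f) es) * mat_adjoint U"
  have n: "dim_row A = n" using assms by auto
  have "\<exists>B. ?P B" using hermitian_spectral[OF assms] unfolding n by blast
  from someI_ex[OF this] have "?P (mat_fun f A)" unfolding mat_fun_def .
  thus ?thesis unfolding n by simp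
qed

text \<open>Whatever \<open>es\<close> the choice used, its multiset is forced to be that of
  \<open>herm_eigvals A\<close>, since both list the roots of the characteristic polynomial.\<close>

lemma mset_sing_vals_mat_fun:
  assumes "A \<in> carrier_mat n n" "mat_adjoint A = A"
  shows "mset (sing_vals (mat_fun f A)) = image_mset (\<lambda>x. \<bar>f x\<bar>) (mset (herm_eigvals A))"
proof -
  from mat_fun_hermitian[OF assms, of f] obtain U es where
    U: "unitary_mat n U" and len: "length es = n"
    and A: "A = U * diag_of_list (map complex_of_real es) * mat_adjoint U"
    and f: "mat_fun f A = U * diag_of_list (map complex_of_real (map f es)) * mat_adjoint U" by blast
  show ?thesis
    unfolding f using mset_sing_vals_unitary_diag[OF U, of "map f es"]
      mset_herm_eigvals_unitary_diag[OF U len, folded A] len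
    by (simp add: multiset.map_comp comp_def)
qed

lemma mset_sing_vals_hermitian:
  assumes "A \<in> carrier_mat n n" "mat_adjoint A = A"
  shows "mset (sing_vals A) = image_mset abs (mset (herm_eigvals A))"
proof -
  from hermitian_spectral[OF assms] obtain U es where
    U: "unitary_mat n U" and len: "length es = n"
    and A: "A = U * diag_of_list (map complex_of_real es) * mat_adjoint U" by blast
  show ?thesis
    using mset_sing_vals_unitary_diag[OF U len, folded A]
      mset_herm_eigvals_unitary_diag[OF U len, folded A] by simp
qed

lemma herm_eigvals_hermitian:
  assumes "A \<in> carrier_mat n n" "mat_adjoint A = A"
  shows "length (herm_eigvals A) = n"
    and "complex_of_real (\<Sum>x\<in>#mset (herm_eigvals A). x ^ k) = mat_trace (A ^\<^sub>m k)"
proof -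
  from hermitian_spectral[OF assms] obtain U es where
    U: "unitary_mat n U" and len: "length es = n"
    and A: "A = U * diag_of_list (map complex_of_real es) * mat_adjoint U" by blast
  note e = mset_herm_eigvals_unitary_diag[OF U len, folded A]
  show "length (herm_eigvals A) = n" using arg_cong[OF e, of size] len by simp
  show "complex_of_real (\<Sum>x\<in>#mset (herm_eigvals A). x ^ k) = mat_trace (A ^\<^sub>m k)"
    unfolding e using trace_pow_unitary_diag[OF U len, of k, folded A]
    by (simp add: mset_map[symmetric] sum_mset_sum_list del: mset_map)
qed

lemma mat_fun_carrier:
  assumes "A \<in> carrier_mat n n" "mat_adjoint A = A"
  shows "mat_fun f A \<in> carrier_mat n n"
  using mat_fun_hermitian[OF assms, of f] by (auto simp: unitary_mat_def)

section \<open>Fourier blocks and T-eigenvalues\<close>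

lemma dft_root_power_p: "p > 0 \<Longrightarrow> dft_root p ^ p = 1"
  unfolding dft_root_def Complex.DeMoivre by (simp add: complex_eq_iff)

lemma dft_root_cnj: "cnj (dft_root p) * dft_root p = 1"
  by (simp add: dft_root_def cis_cnj cis_mult)

text \<open>\<open>cnj (dft_root p)\<close> is \<open>exp (2 pi i / p)\<close>, so its powers below
  \<open>p\<close> run through the roots of unity in their standard, injective enumeration.\<close>

lemma cnj_dft_root_power_inj:
  assumes "k < p" "l < p" "cnj (dft_root p) ^ k = cnj (dft_root p) ^ l"
  shows "k = l"
proof -
  have "cnj (dft_root p) ^ i = cis (2 * pi * real i / real p)" for i
    unfolding dft_root_def cis_cnj Complex.DeMoivre by (simp add: mult_ac)
  moreover have "inj_on (\<lambda>k. cis (2 * pi * real k / real p)) {..<p}"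
    using Complex.bij_betw_roots_unity[of p] assms(1) by (auto simp: bij_betw_def)
  ultimately show ?thesis using assms by (auto simp: inj_on_def)
qed

text \<open>A geometric sum whose ratio \<open>z\<close> is a root of unity of order dividing
  \<open>p\<close>, equal to 1 exactly when \<open>k = l\<close>.\<close>

lemma dft_orthogonality:
  assumes "k < p" "l < p"
  shows "(\<Sum>j<p. dft_root p ^ (j * k) * cnj (dft_root p) ^ (j * l)) = (if k = l then of_nat p else 0)"
proof -
  let ?w = "dft_root p"
  define z where "z = ?w ^ k * cnj ?w ^ l"
  have p: "p > 0" using assms by simp
  have w: "?w * cnj ?w = 1" using dft_root_cnj[of p] by (simp add: mult.commute)
  have sum: "(\<Sum>j<p. ?w ^ (j * k) * cnj ?w ^ (j * l)) = (\<Sum>j<p. z ^ j)"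
    by (simp add: z_def power_mult_distrib power_mult[symmetric] mult.commute)
  show ?thesis
  proof (cases "k = l")
    case True
    hence "z = 1" by (simp add: z_def power_mult_distrib[symmetric] w)
    thus ?thesis using True sum by simp
  next
    case False
    have "z \<noteq> 1"
    proof
      assume "z = 1"
      have "cnj ?w ^ k = cnj ?w ^ k * z" using \<open>z = 1\<close> by simp
      also have "\<dots> = (?w * cnj ?w) ^ k * cnj ?w ^ l"
        unfolding z_def power_mult_distrib by (simp add: mult_ac)
      finally have "cnj ?w ^ k = cnj ?w ^ l" using w by simp
      with cnj_dft_root_power_inj[OF assms] False show False by blast
    qed
    moreover have "z ^ p = 1"
    proof -
      have "z ^ p = (?w ^ p) ^ k * cnj (?w ^ p) ^ l"
        by (simp add: z_def power_mult_distrib power_mult[symmetric] mult.commute)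
      thus ?thesis using dft_root_power_p[OF p] by simp
    qed
    ultimately show ?thesis using False sum by (simp add: geometric_sum)
  qed
qed

text \<open>Inversion of the discrete Fourier transform. It allows the singular values of
  \<open>t_fun m p f C\<close> to be computed block by block.\<close>

lemma fourier_block_tensor_of_blocks:
  assumes k: "k < p" and B: "B k \<in> carrier_mat m m"
  shows "fourier_block m p (tensor_of_blocks m p B) k = B k"
proof (rule eq_matI)
  fix a b assume "a < dim_row (B k)" "b < dim_col (B k)"
  hence ab: "a < m" "b < m" using B by auto
  let ?w = "dft_root p"
  have "fourier_block m p (tensor_of_blocks m p B) k $$ (a, b) =
    (\<Sum>j<p. \<Sum>l<p. B l $$ (a, b) * (?w ^ (j * k) * cnj ?w ^ (j * l)) / of_nat p)"
    using ab by (simp add: fourier_block_def tensor_of_blocks_def sum_distrib_left sum_divide_distrib mult_ac)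
  also have "\<dots> = (\<Sum>l<p. B l $$ (a, b) * (\<Sum>j<p. ?w ^ (j * k) * cnj ?w ^ (j * l)) / of_nat p)"
    by (subst sum.swap) (simp add: sum_distrib_left sum_divide_distrib)
  also have "\<dots> = (\<Sum>l<p. if k = l then B l $$ (a, b) else 0)"
    using k by (intro sum.cong) (auto simp: dft_orthogonality)
  finally show "fourier_block m p (tensor_of_blocks m p B) k $$ (a, b) = B k $$ (a, b)"
    using k by simp
qed (use B in \<open>auto simp: fourier_block_def\<close>)

lemma fourier_block_carrier [simp]: "fourier_block m p C k \<in> carrier_mat m m"
  by (simp add: fourier_block_def)

lemma fourier_block_cplx_tensor_index:
  assumes C: "t_symmetric m p C" and ab: "a < m" "b < m"
  shows "fourier_block m p (cplx_tensor C) k $$ (a, b) =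
    (\<Sum>j<p. dft_root p ^ (j * k) * complex_of_real (C j $$ (a, b)))"
proof -
  have "map_mat complex_of_real (C j) $$ (a, b) = complex_of_real (C j $$ (a, b))" if "j < p" for j
    using C ab that by (intro index_map_mat) (auto simp: t_symmetric_def is_tensor_def)
  thus ?thesis unfolding fourier_block_def cplx_tensor_def using ab by simp
qed

text \<open>T-symmetry turns transposition of a slice into the reflection of \<open>j\<close> to
  \<open>-j\<close> modulo \<open>p\<close>, and conjugation does the same to the exponent of the
  root of unity. The slices are real, so reindexing by this reflection gives back the block.\<close>

lemma fourier_block_hermitian:
  assumes C: "t_symmetric m p C"
  shows "mat_adjoint (fourier_block m p (cplx_tensor C) k) = fourier_block m p (cplx_tensor C) k"
proof (rule eq_matI)
  let ?w = "dft_root p"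
  fix a b assume "a < dim_row (fourier_block m p (cplx_tensor C) k)"
    "b < dim_col (fourier_block m p (cplx_tensor C) k)"
  hence a: "a < m" and b: "b < m" by (auto simp: fourier_block_def)
  have car: "C j \<in> carrier_mat m m" if "j < p" for j
    using C that by (auto simp: t_symmetric_def is_tensor_def)
  note ent = fourier_block_cplx_tensor_index[OF C]
  \<comment> \<open>The outer \<open>mod p\<close> sends \<open>j = 0\<close> to 0, so that
    \<open>r\<close> is an involution of the indices below \<open>p\<close>.\<close>
  define r where "r j = (p - j) mod p" for j
  have r: "r j < p" "r (r j) = j" if "j < p" for j
    using that by (cases "j = 0"; simp add: r_def)+
  have sym: "C j $$ (b, a) = C (r j) $$ (a, b)" if j: "j < p" for j
  proof -
    have "C j = transpose_mat (C (r j))"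
      using C j by (auto simp: t_symmetric_def t_transpose_def r_def)
    thus ?thesis using car[OF r(1)[OF j]] a b by (metis carrier_matD index_transpose_mat(1))
  qed
  have pow: "cnj ?w ^ (j * k) = ?w ^ (r j * k)" if j: "j < p" for j
  proof -
    have "?w ^ (j + r j) = 1"
      using j dft_root_power_p[of p] by (cases "j = 0") (auto simp: r_def)
    hence "?w ^ (j * k) * ?w ^ (r j * k) = 1"
      by (metis add_mult_distrib power_add power_mult power_one)
    moreover have "cnj ?w ^ (j * k) * ?w ^ (j * k) = 1"
      by (metis dft_root_cnj power_mult_distrib power_one)
    ultimately show ?thesis by (metis mult.assoc mult.right_neutral mult.left_neutral)
  qed
  have "mat_adjoint (fourier_block m p (cplx_tensor C) k) $$ (a, b) =
    (\<Sum>j<p. cnj ?w ^ (j * k) * complex_of_real (C j $$ (b, a)))"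
    using a b carrier_matD[OF fourier_block_carrier[of m p "cplx_tensor C" k]]
    by (simp add: ent)
  also have "\<dots> = (\<Sum>j<p. ?w ^ (r j * k) * complex_of_real (C (r j) $$ (a, b)))"
    by (intro sum.cong) (auto simp: sym pow)
  also have "\<dots> = (\<Sum>j<p. ?w ^ (j * k) * complex_of_real (C j $$ (a, b)))"
    by (rule sum.reindex_bij_witness[of _ r r]) (auto simp: r)
  finally show "mat_adjoint (fourier_block m p (cplx_tensor C) k) $$ (a, b) =
    fourier_block m p (cplx_tensor C) k $$ (a, b)" using a b by (simp add: ent)
qed (auto simp: fourier_block_def)

section \<open>T-eigenvalues and T-singular values as multisets collected over the blocks\<close>

lemma mset_concat_upt: "mset (concat (map f [0..<p])) = (\<Sum>k<p. mset (f k))"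
  by (induction p) (auto simp: add.commute)

lemma mset_t_eigvals:
  "mset (t_eigvals m p C) = (\<Sum>k<p. mset (herm_eigvals (fourier_block m p (cplx_tensor C) k)))"
  by (simp add: t_eigvals_def mset_concat_upt)

lemma mset_t_singvals:
  "mset (t_singvals m p C) = (\<Sum>k<p. mset (sing_vals (fourier_block m p C k)))"
  by (simp add: t_singvals_def mset_concat_upt)

lemma image_mset_sum: "image_mset f (\<Sum>k\<in>A. g k) = (\<Sum>k\<in>A. image_mset f (g k))"
  by (induction A rule: infinite_finite_induct) auto

lemma sum_mset_sum: "sum_mset (\<Sum>k\<in>A. g k) = (\<Sum>k\<in>A. sum_mset (g k))"
  by (induction A rule: infinite_finite_induct) auto

lemma mset_t_singvals_t_fun:
  assumes "t_symmetric m p C"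
  shows "mset (t_singvals m p (t_fun m p f C)) = image_mset (\<lambda>x. \<bar>f x\<bar>) (mset (t_eigvals m p C))"
  unfolding mset_t_singvals mset_t_eigvals image_mset_sum t_fun_def
  by (intro sum.cong refl, subst fourier_block_tensor_of_blocks)
    (auto intro!: mset_sing_vals_mat_fun[where n = m] mat_fun_carrier[where n = m]
      fourier_block_hermitian assms)

lemma mset_t_singvals_cplx_tensor:
  assumes "t_symmetric m p C"
  shows "mset (t_singvals m p (cplx_tensor C)) = image_mset abs (mset (t_eigvals m p C))"
  unfolding mset_t_singvals mset_t_eigvals image_mset_sum
  by (intro sum.cong refl mset_sing_vals_hermitian[where n = m] fourier_block_hermitian assms) auto

lemma length_t_eigvals:
  assumes "t_symmetric m p C"
  shows "length (t_eigvals m p C) = m * p"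
proof -
  have "length (t_eigvals m p C) = size (mset (t_eigvals m p C))" by simp
  also have "\<dots> = (\<Sum>k<p. m)"
    unfolding mset_t_eigvals size_multiset_sum
    using herm_eigvals_hermitian(1)[OF fourier_block_carrier fourier_block_hermitian[OF assms]]
    by simp
  finally show ?thesis by simp
qed

text \<open>The right-hand side is the real part of a polynomial in the entries of the slices: here
  the ordered eigenvalues are traded for quantities whose measurability is evident.\<close>

lemma t_eigvals_power_sum:
  assumes "t_symmetric m p C"
  shows "(\<Sum>x\<leftarrow>t_eigvals m p C. x ^ n) =
    Re (\<Sum>k<p. mat_trace (fourier_block m p (cplx_tensor C) k ^\<^sub>m n))"
proof -
  have "complex_of_real (\<Sum>x\<leftarrow>t_eigvals m p C. x ^ n) =
    complex_of_real (\<Sum>x\<in>#mset (t_eigvals m p C). x ^ n)"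
    by (simp add: mset_map[symmetric] sum_mset_sum_list del: mset_map)
  also have "(\<Sum>x\<in>#mset (t_eigvals m p C). x ^ n) =
     (\<Sum>k<p. \<Sum>x\<in>#mset (herm_eigvals (fourier_block m p (cplx_tensor C) k)). x ^ n)"
    unfolding mset_t_eigvals image_mset_sum sum_mset_sum ..
  finally have "complex_of_real (\<Sum>x\<leftarrow>t_eigvals m p C. x ^ n) =
    (\<Sum>k<p. mat_trace (fourier_block m p (cplx_tensor C) k ^\<^sub>m n))"
    using herm_eigvals_hermitian(2)[OF fourier_block_carrier fourier_block_hermitian[OF assms]]
    by simp
  thus ?thesis by (metis Re_complex_of_real)
qed

section \<open>Measurability of ordered eigenvalues\<close>

lemma measurable_sum_poly:
  fixes X :: "'a \<Rightarrow> nat \<Rightarrow> real"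
  assumes pow: "\<And>n. (\<lambda>\<omega>. \<Sum>i<N. X \<omega> i ^ n) \<in> borel_measurable M"
    and g: "real_polynomial_function g"
  shows "(\<lambda>\<omega>. \<Sum>i<N. g (X \<omega> i)) \<in> borel_measurable M"
proof -
  from g obtain a n where g: "g = (\<lambda>x. \<Sum>k\<le>n. a k * x ^ k)"
    unfolding real_polynomial_function_iff_sum by blast
  have "(\<lambda>\<omega>. \<Sum>i<N. g (X \<omega> i)) = (\<lambda>\<omega>. \<Sum>k\<le>n. a k * (\<Sum>i<N. X \<omega> i ^ k))"
    unfolding g sum_distrib_left by (subst sum.swap) simp
  thus ?thesis using pow by simp
qed

text \<open>The bound puts all values into the compact interval from \<open>-B\<close> to
  \<open>B\<close>, on which polynomials approximate \<open>h\<close> by Weierstrass; the sums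
  converge pointwise, and measurability survives such limits.\<close>

lemma measurable_sum_continuous:
  fixes X :: "'a \<Rightarrow> nat \<Rightarrow> real"
  assumes pow: "\<And>n. (\<lambda>\<omega>. \<Sum>i<N. X \<omega> i ^ n) \<in> borel_measurable M"
    and bnd: "\<And>\<omega> i. i < N \<Longrightarrow> \<bar>X \<omega> i\<bar> \<le> B"
    and h: "continuous_on UNIV (h :: real \<Rightarrow> real)"
  shows "(\<lambda>\<omega>. \<Sum>i<N. h (X \<omega> i)) \<in> borel_measurable M"
proof -
  have "\<exists>g. real_polynomial_function g \<and> (\<forall>x\<in>{-B..B}. \<bar>h x - g x\<bar> < 1 / real (Suc n))" for n
  proof -
    have "compact {-B..B}" "continuous_on {-B..B} h" "0 < 1 / real (Suc n)"
      using continuous_on_subset[OF h] by auto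
    thus ?thesis by (rule Stone_Weierstrass_real_polynomial_function) auto
  qed
  then obtain g where g: "\<And>n. real_polynomial_function (g n)"
    "\<And>n x. x \<in> {-B..B} \<Longrightarrow> \<bar>h x - g n x\<bar> < 1 / real (Suc n)" by metis
  have lim: "(\<lambda>n. g n x) \<longlonglongrightarrow> h x" if "x \<in> {-B..B}" for x
  proof (rule LIMSEQ_I)
    fix e :: real assume "e > 0"
    then obtain n0 where n0: "1 / real (Suc n0) < e" using nat_approx_posE by blast
    have "norm (g n x - h x) < e" if "n \<ge> n0" for n
    proof -
      have "norm (g n x - h x) < 1 / real (Suc n)" using g(2)[OF \<open>x \<in> {-B..B}\<close>, of n] by (simp add: abs_minus_commute)
      also have "\<dots> \<le> 1 / real (Suc n0)" using that by (simp add: frac_le)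
      finally show ?thesis using n0 by linarith
    qed
    thus "\<exists>n0. \<forall>n\<ge>n0. norm (g n x - h x) < e" by blast
  qed
  show ?thesis
  proof (rule borel_measurable_LIMSEQ_real)
    show "(\<lambda>n. \<Sum>i<N. g n (X \<omega> i)) \<longlonglongrightarrow> (\<Sum>i<N. h (X \<omega> i))" for \<omega>
      using bnd by (intro tendsto_sum lim) (auto simp: abs_le_iff minus_le_iff)
    show "(\<lambda>\<omega>. \<Sum>i<N. g n (X \<omega> i)) \<in> borel_measurable M" for n
      by (rule measurable_sum_poly[OF pow g(1)])
  qed
qed

text \<open>Continuous ramps increasing to the indicator of an open half line; at
  \<open>x = t\<close> all of them vanish, in accordance with the strict inequality.\<close>

lemma ramp_tendsto_indicator:
  fixes x t :: real
  shows "(\<lambda>n. min 1 (real n * max 0 (x - t))) \<longlonglongrightarrow> indicator {t<..} x"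
proof (cases "x > t")
  case True
  have "eventually (\<lambda>n. real n * (x - t) \<ge> 1) sequentially"
    using True by real_asymp
  hence "eventually (\<lambda>n. min 1 (real n * max 0 (x - t)) = 1) sequentially"
    by eventually_elim (use True in auto)
  thus ?thesis using True by (simp add: tendsto_eventually)
qed auto

text \<open>In a decreasing vector, entry \<open>i\<close> exceeds \<open>t\<close> exactly when
  more than \<open>i\<close> entries do, indices starting at 0. The count \<open>?c\<close> is
  symmetric in the entries, hence a limit of functions governed by the power sums.\<close>

lemma measurable_sorted_nth:
  fixes X :: "'a \<Rightarrow> nat \<Rightarrow> real"
  assumes pow: "\<And>n. (\<lambda>\<omega>. \<Sum>i<N. X \<omega> i ^ n) \<in> borel_measurable M"
    and bnd: "\<And>\<omega> i. i < N \<Longrightarrow> \<bar>X \<omega> i\<bar> \<le> B"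
    and dec: "\<And>\<omega> i j. i \<le> j \<Longrightarrow> j < N \<Longrightarrow> X \<omega> j \<le> X \<omega> i"
    and i: "i < N"
  shows "(\<lambda>\<omega>. X \<omega> i) \<in> borel_measurable M"
  unfolding borel_measurable_iff_greater
proof
  fix t :: real
  let ?c = "\<lambda>\<omega>. \<Sum>j<N. indicator {t<..} (X \<omega> j) :: real"
  have meas: "?c \<in> borel_measurable M"
  proof (rule borel_measurable_LIMSEQ_real)
    show "(\<lambda>n. \<Sum>j<N. min 1 (real n * max 0 (X \<omega> j - t))) \<longlonglongrightarrow> ?c \<omega>" for \<omega>
      by (intro tendsto_sum ramp_tendsto_indicator)
    show "(\<lambda>\<omega>. \<Sum>j<N. min 1 (real n * max 0 (X \<omega> j - t))) \<in> borel_measurable M" for n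
      by (rule measurable_sum_continuous[OF pow bnd]) (auto intro!: continuous_intros)
  qed
  have "t < X \<omega> i \<longleftrightarrow> real i < ?c \<omega>" for \<omega>
  proof
    assume "t < X \<omega> i"
    hence "indicator {t<..} (X \<omega> j) = (1 :: real)" if "j < Suc i" for j
      using dec[of j i \<omega>] that i by auto
    hence "real (Suc i) = (\<Sum>j<Suc i. indicator {t<..} (X \<omega> j))" by simp
    also have "\<dots> \<le> ?c \<omega>" using i by (intro sum_mono2) auto
    finally show "real i < ?c \<omega>" by simp
  next
    assume *: "real i < ?c \<omega>"
    show "t < X \<omega> i"
    proof (rule ccontr)
      assume "\<not> t < X \<omega> i"
      hence "indicator {t<..} (X \<omega> j) = (0 :: real)" if "i \<le> j" "j < N" for j
        using dec[of i j \<omega>] that by auto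
      hence "?c \<omega> = (\<Sum>j<i. indicator {t<..} (X \<omega> j))"
        using i by (intro sum.mono_neutral_right) auto
      also have "\<dots> \<le> (\<Sum>j<i. 1)" by (intro sum_mono) (auto simp: indicator_def)
      finally show False using * by simp
    qed
  qed
  hence "{\<omega> \<in> space M. t < X \<omega> i} = {\<omega> \<in> space M. real i < ?c \<omega>}" by simp
  also have "\<dots> \<in> sets M" using meas by measurable
  finally show "{\<omega> \<in> space M. t < X \<omega> i} \<in> sets M" .
qed

lemma measurable_pow_mat:
  fixes A :: "'a \<Rightarrow> complex mat"
  assumes car: "\<And>\<omega>. A \<omega> \<in> carrier_mat n n"
    and meas: "\<And>i j. i < n \<Longrightarrow> j < n \<Longrightarrow> (\<lambda>\<omega>. A \<omega> $$ (i, j)) \<in> borel_measurable M"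
    and "i < n" "j < n"
  shows "(\<lambda>\<omega>. (A \<omega> ^\<^sub>m k) $$ (i, j)) \<in> borel_measurable M"
  using assms(3,4)
proof (induction k arbitrary: j)
  case 0
  have "dim_row (A \<omega>) = n" for \<omega> using car by auto
  thus ?case using 0 by simp
next
  case (Suc k)
  have "(A \<omega> ^\<^sub>m Suc k) $$ (i, j) = (\<Sum>l<n. (A \<omega> ^\<^sub>m k) $$ (i, l) * A \<omega> $$ (l, j))" for \<omega>
    using car[of \<omega>] pow_carrier_mat[OF car, of \<omega> k] Suc.prems
    by (simp add: scalar_prod_def lessThan_atLeast0)
  thus ?case using Suc meas by simp
qed

section \<open>Symmetric gauge functions\<close>

text \<open>Gauges act on lists, but vectors are handled as functions of the index, so that sums,
  updates and integrals can be written coordinatewise. Only the values below \<open>n\<close>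
  matter.\<close>

abbreviation on_vec :: "(real list \<Rightarrow> real) \<Rightarrow> nat \<Rightarrow> (nat \<Rightarrow> real) \<Rightarrow> real" where
  "on_vec \<rho> n x \<equiv> \<rho> (map x [0..<n])"

lemma gauge_cong: "(\<And>i. i < n \<Longrightarrow> x i = y i) \<Longrightarrow> on_vec \<rho> n x = on_vec \<rho> n y"
  by (rule arg_cong[of _ _ \<rho>]) simp

lemma sym_gaugeD:
  assumes "sym_gauge n \<rho>" "length x = n"
  shows "\<rho> x \<ge> 0" "\<rho> x = 0 \<longleftrightarrow> x = replicate n 0" "\<rho> (map (\<lambda>t. c * t) x) = \<bar>c\<bar> * \<rho> x"
    "length y = n \<Longrightarrow> \<rho> (map2 (+) x y) \<le> \<rho> x + \<rho> y"
    "mset x = mset y \<Longrightarrow> \<rho> y = \<rho> x" "\<rho> (map abs x) = \<rho> x"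
  using assms unfolding sym_gauge_def by blast+

context
  fixes \<rho> n assumes G: "sym_gauge n \<rho>"
begin

lemma gauge_nonneg: "on_vec \<rho> n x \<ge> 0"
  by (rule sym_gaugeD(1)[OF G]) simp

lemma gauge_zero: "on_vec \<rho> n (\<lambda>_. 0) = 0"
  by (subst sym_gaugeD(2)[OF G]) (simp_all add: map_replicate_const)

lemma gauge_scale: "on_vec \<rho> n (\<lambda>i. c * x i) = \<bar>c\<bar> * on_vec \<rho> n x"
proof -
  have "\<rho> (map (\<lambda>t. c * t) (map x [0..<n])) = \<bar>c\<bar> * \<rho> (map x [0..<n])"
    by (rule sym_gaugeD(3)[OF G]) simp
  thus ?thesis by (simp add: comp_def)
qed

lemma gauge_add: "on_vec \<rho> n (\<lambda>i. x i + y i) \<le> on_vec \<rho> n x + on_vec \<rho> n y"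
proof -
  have "\<rho> (map2 (+) (map x [0..<n]) (map y [0..<n])) \<le> \<rho> (map x [0..<n]) + \<rho> (map y [0..<n])"
    by (rule sym_gaugeD(4)[OF G]) simp_all
  also have "map2 (+) (map x [0..<n]) (map y [0..<n]) = map (\<lambda>i. x i + y i) [0..<n]"
    by (rule nth_equalityI) auto
  finally show ?thesis .
qed

lemma gauge_abs: "on_vec \<rho> n (\<lambda>i. \<bar>x i\<bar>) = on_vec \<rho> n x"
proof -
  have "\<rho> (map abs (map x [0..<n])) = \<rho> (map x [0..<n])"
    by (rule sym_gaugeD(6)[OF G]) simp
  thus ?thesis by (simp add: comp_def)
qed

lemma gauge_swap:
  assumes "j < n" "k < n"
  shows "on_vec \<rho> n (x(j := x k, k := x j)) = on_vec \<rho> n x"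
proof -
  have "map (x(j := x k, k := x j)) [0..<n] = (map x [0..<n])[j := map x [0..<n] ! k, k := map x [0..<n] ! j]"
    by (rule nth_equalityI) (use assms in \<open>auto simp: nth_list_update\<close>)
  also have "mset \<dots> = mset (map x [0..<n])"
    using assms by (intro mset_swap) auto
  finally show ?thesis by (intro sym_gaugeD(5)[OF G]) simp_all
qed

text \<open>Meant for two symmetries of the gauge: with \<open>y\<close> a sign change of
  \<open>x\<close> it yields monotonicity, with \<open>y\<close> an exchange of two entries it
  yields the transfer step of the dominance argument.\<close>

lemma gauge_convex:
  assumes "0 \<le> t" "t \<le> 1" "on_vec \<rho> n y = on_vec \<rho> n x"
    and "\<And>i. i < n \<Longrightarrow> z i = (1 - t) * x i + t * y i"
  shows "on_vec \<rho> n z \<le> on_vec \<rho> n x"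
proof -
  have "on_vec \<rho> n z = on_vec \<rho> n (\<lambda>i. (1 - t) * x i + t * y i)"
    by (rule gauge_cong) (rule assms(4))
  also have "\<dots> \<le> on_vec \<rho> n (\<lambda>i. (1 - t) * x i) + on_vec \<rho> n (\<lambda>i. t * y i)"
    by (rule gauge_add)
  also have "\<dots> = (1 - t) * on_vec \<rho> n x + t * on_vec \<rho> n x"
    unfolding gauge_scale using assms(1-3) by simp
  finally show ?thesis by (simp add: algebra_simps)
qed

text \<open>The new entry lies between \<open>- x k\<close> and \<open>x k\<close>, and flipping the
  sign of entry \<open>k\<close> leaves the gauge unchanged, so convexity applies.\<close>

lemma gauge_mono_single:
  assumes "0 \<le> t" "t \<le> x k"
  shows "on_vec \<rho> n (x(k := t)) \<le> on_vec \<rho> n x"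
proof (cases "x k = 0")
  case True
  with assms have "x(k := t) = x" by auto
  thus ?thesis by simp
next
  case False
  with assms have xk: "x k > 0" by auto
  have "on_vec \<rho> n (x(k := - x k)) = on_vec \<rho> n x"
    by (subst (1 2) gauge_abs[symmetric]) (rule gauge_cong, simp)
  \<comment> \<open>The weight \<open>w\<close> solves
    \<open>(1 - w) * x k + w * (- x k) = t\<close>.\<close>
  thus ?thesis
    by (rule gauge_convex[of "(1 - t / x k) / 2", rotated 2])
      (use assms xk in \<open>auto simp: field_simps\<close>)
qed

lemma gauge_mono:
  assumes "\<And>i. i < n \<Longrightarrow> 0 \<le> x i" "\<And>i. i < n \<Longrightarrow> x i \<le> y i"
  shows "on_vec \<rho> n x \<le> on_vec \<rho> n y"
proof -
  \<comment> \<open>Hybrid vectors that pass from \<open>y\<close> to \<open>x\<close> by lowering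
    one coordinate at a time.\<close>
  define z where "z j = (\<lambda>i. if i < j then x i else y i)" for j
  have "on_vec \<rho> n (z j) \<le> on_vec \<rho> n y" if "j \<le> n" for j
    using that
  proof (induction j)
    case 0
    show ?case by (simp add: z_def)
  next
    case (Suc j)
    have eq: "z (Suc j) = (z j)(j := x j)" by (auto simp: z_def)
    have "on_vec \<rho> n (z (Suc j)) \<le> on_vec \<rho> n (z j)"
      unfolding eq using Suc.prems assms by (intro gauge_mono_single) (auto simp: z_def)
    with Suc show ?case by linarith
  qed
  from this[of n] have "on_vec \<rho> n (z n) \<le> on_vec \<rho> n y" by simp
  thus ?thesis using gauge_cong[of n "z n" x \<rho>] by (simp add: z_def)
qed

lemma gauge_sum:
  assumes "finite S" "\<And>v. v \<in> S \<Longrightarrow> 0 \<le> c v"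
  shows "on_vec \<rho> n (\<lambda>i. \<Sum>v\<in>S. c v * V v i) \<le> (\<Sum>v\<in>S. c v * on_vec \<rho> n (V v))"
  using assms
proof (induction S rule: finite_induct)
  case empty
  thus ?case using gauge_zero by simp
next
  case (insert v S)
  have "on_vec \<rho> n (\<lambda>i. c v * V v i + (\<Sum>v\<in>S. c v * V v i)) \<le>
    on_vec \<rho> n (\<lambda>i. c v * V v i) + on_vec \<rho> n (\<lambda>i. \<Sum>v\<in>S. c v * V v i)"
    by (rule gauge_add)
  also have "on_vec \<rho> n (\<lambda>i. c v * V v i) = c v * on_vec \<rho> n (V v)"
    using insert.prems by (simp add: gauge_scale)
  finally show ?case using insert by simp
qed

text \<open>Expanding \<open>x - y\<close> in unit vectors gives the bound. It is the source of the
  continuity of the gauge and of the rounding error in Jensen's inequality.\<close>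

lemma gauge_lipschitz:
  "\<bar>on_vec \<rho> n x - on_vec \<rho> n y\<bar> \<le> (\<Sum>k<n. \<bar>x k - y k\<bar> * on_vec \<rho> n (indicator {k}))"
proof -
  have *: "on_vec \<rho> n x - on_vec \<rho> n y \<le> (\<Sum>k<n. \<bar>x k - y k\<bar> * on_vec \<rho> n (indicator {k}))" for x y
  proof -
    let ?d = "\<lambda>i. \<Sum>k<n. \<bar>x k - y k\<bar> * indicator {k} i"
    have "on_vec \<rho> n x = on_vec \<rho> n (\<lambda>i. y i + (x i - y i))" by simp
    also have "\<dots> \<le> on_vec \<rho> n y + on_vec \<rho> n (\<lambda>i. x i - y i)" by (rule gauge_add)
    also have "on_vec \<rho> n (\<lambda>i. x i - y i) = on_vec \<rho> n (\<lambda>i. \<bar>x i - y i\<bar>)"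
      by (rule gauge_abs[symmetric])
    also have "\<dots> = on_vec \<rho> n ?d"
      by (rule gauge_cong) (simp add: indicator_def if_distrib if_distribR cong: if_cong)
    also have "\<dots> \<le> (\<Sum>k<n. \<bar>x k - y k\<bar> * on_vec \<rho> n (indicator {k}))"
      by (rule gauge_sum) auto
    finally show ?thesis by simp
  qed
  have "(\<Sum>k<n. \<bar>y k - x k\<bar> * on_vec \<rho> n (indicator {k})) = (\<Sum>k<n. \<bar>x k - y k\<bar> * on_vec \<rho> n (indicator {k}))"
    by (simp add: abs_minus_commute)
  with *[of x y] *[of y x] show ?thesis by linarith
qed

lemma gauge_measurable:
  assumes meas: "\<And>i. i < n \<Longrightarrow> (\<lambda>\<omega>. g \<omega> i) \<in> borel_measurable M"
  shows "(\<lambda>\<omega>. on_vec \<rho> n (g \<omega>)) \<in> borel_measurable M"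
proof -
  \<comment> \<open>Continuity is stated in the product topology of all functions on the naturals,
    so the coordinates from \<open>n\<close> on are set to 0 to be measurable.\<close>
  let ?h = "\<lambda>\<omega> i. if i < n then g \<omega> i else 0"
  have cont: "continuous_on UNIV (\<lambda>x :: nat \<Rightarrow> real. on_vec \<rho> n x)"
    unfolding continuous_on_def
  proof (intro ballI)
    fix x :: "nat \<Rightarrow> real"
    have coord: "((\<lambda>y. y k) \<longlongrightarrow> x k) (at x)" for k
    proof -
      have "continuous_on UNIV (\<lambda>y :: nat \<Rightarrow> real. y k)" by (rule continuous_on_product_coordinates)
      thus ?thesis by (simp add: continuous_on_def)
    qed
    have "((\<lambda>y. \<Sum>k<n. \<bar>y k - x k\<bar> * on_vec \<rho> n (indicator {k})) \<longlongrightarrow>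
      (\<Sum>k<n. \<bar>x k - x k\<bar> * on_vec \<rho> n (indicator {k}))) (at x)"
      by (intro tendsto_intros coord)
    hence "((\<lambda>y. \<Sum>k<n. \<bar>y k - x k\<bar> * on_vec \<rho> n (indicator {k})) \<longlongrightarrow> 0) (at x)" by simp
    hence "((\<lambda>y. on_vec \<rho> n y - on_vec \<rho> n x) \<longlongrightarrow> 0) (at x)"
      by (rule Lim_null_comparison[rotated]) (auto intro!: always_eventually gauge_lipschitz)
    thus "((\<lambda>y. on_vec \<rho> n y) \<longlongrightarrow> on_vec \<rho> n x) (at x within UNIV)"
      using Lim_null by blast
  qed
  have "?h \<in> borel_measurable M"
  proof (rule measurable_coordinatewise_then_product)
    show "(\<lambda>\<omega>. if i < n then g \<omega> i else 0) \<in> borel_measurable M" for i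
      using meas by (cases "i < n") auto
  qed
  from measurable_compose[OF this borel_measurable_continuous_onI[OF cont]]
  have "(\<lambda>\<omega>. on_vec \<rho> n (?h \<omega>)) \<in> borel_measurable M" .
  moreover have "on_vec \<rho> n (?h \<omega>) = on_vec \<rho> n (g \<omega>)" for \<omega>
    by (rule gauge_cong) simp
  ultimately show ?thesis by (simp only:)
qed

lemma gauge_integrable:
  assumes M: "finite_measure M"
    and meas: "\<And>i. i < n \<Longrightarrow> (\<lambda>\<omega>. g \<omega> i) \<in> borel_measurable M"
    and bnd: "\<And>\<omega> i. i < n \<Longrightarrow> \<bar>g \<omega> i\<bar> \<le> B"
  shows "integrable M (\<lambda>\<omega>. on_vec \<rho> n (g \<omega>))"
proof -
  have "on_vec \<rho> n (g \<omega>) \<le> on_vec \<rho> n (\<lambda>_. B)" for \<omega>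
    by (subst gauge_abs[symmetric]) (rule gauge_mono, use bnd in auto)
  thus ?thesis
    by (intro finite_measure.integrable_const_bound[OF M, where B = "on_vec \<rho> n (\<lambda>_. B)"]
      gauge_measurable meas) (auto simp: gauge_nonneg)
qed

section \<open>Jensen's inequality for gauges\<close>

text \<open>The vector integral is a finite combination of the values \<open>v\<close> with weights
  \<open>measure M (A v)\<close>, so subadditivity and homogeneity give the claim. Members of an
  extensional \<open>S\<close> are determined by their first \<open>n\<close> coordinates, which
  makes the level sets \<open>A v\<close> disjoint.\<close>

lemma gauge_jensen_finite_range:
  assumes M: "finite_measure M" and S: "finite S"
    and range: "\<And>\<omega>. \<omega> \<in> space M \<Longrightarrow> \<exists>v\<in>S. \<forall>i<n. g \<omega> i = v i"
    and S_ext: "S \<subseteq> extensional {..<n}"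
    and meas: "\<And>i. i < n \<Longrightarrow> (\<lambda>\<omega>. g \<omega> i) \<in> borel_measurable M"
  shows "on_vec \<rho> n (\<lambda>i. \<integral>\<omega>. g \<omega> i \<partial>M) \<le> (\<integral>\<omega>. on_vec \<rho> n (g \<omega>) \<partial>M)"
proof -
  interpret finite_measure M by fact
  define A where "A v = {\<omega> \<in> space M. \<forall>i<n. g \<omega> i = v i}" for v
  have A[measurable]: "A v \<in> sets M" for v
  proof -
    have "A v = {\<omega> \<in> space M. \<forall>i\<in>{..<n}. g \<omega> i = v i}" by (auto simp: A_def)
    also have "\<dots> \<in> sets M" using meas by (intro sets.sets_Collect_finite_All) auto
    finally show ?thesis .
  qed
  have sum_A: "(\<Sum>v\<in>S. indicator (A v) \<omega> * F v) = F w"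
    if w: "w \<in> S" "\<omega> \<in> A w" for F :: "(nat \<Rightarrow> real) \<Rightarrow> real" and \<omega> w
  proof -
    have vw: "v = w" if v: "v \<in> S" "\<omega> \<in> A v" for v
    proof (rule extensionalityI)
      show "v \<in> extensional {..<n}" "w \<in> extensional {..<n}" using v w S_ext by blast+
      show "v i = w i" if "i \<in> {..<n}" for i
        using v(2) w(2) that unfolding A_def by (metis (mono_tags, lifting) lessThan_iff mem_Collect_eq)
    qed
    have "(\<Sum>v\<in>S. indicator (A v) \<omega> * F v) = (\<Sum>v\<in>S. if v = w then F w else 0)"
    proof (rule sum.cong[OF refl])
      fix v assume "v \<in> S"
      with vw[of v] w(2) show "indicator (A v) \<omega> * F v = (if v = w then F w else 0)"
        by (cases "\<omega> \<in> A v") auto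
    qed
    thus ?thesis using w S by simp
  qed
  have int_A: "(\<integral>\<omega>. (\<Sum>v\<in>S. indicator (A v) \<omega> * F v) \<partial>M) = (\<Sum>v\<in>S. measure M (A v) * F v)"
    for F :: "(nat \<Rightarrow> real) \<Rightarrow> real"
  proof -
    have "integrable M (indicat_real (A v))" for v
      by (rule integrable_real_indicator[OF A]) (simp add: emeasure_eq_measure)
    thus ?thesis by (subst Bochner_Integration.integral_sum) auto
  qed
  have "(\<integral>\<omega>. g \<omega> i \<partial>M) = (\<Sum>v\<in>S. measure M (A v) * v i)" if "i < n" for i
  proof -
    have "(\<integral>\<omega>. g \<omega> i \<partial>M) = (\<integral>\<omega>. (\<Sum>v\<in>S. indicator (A v) \<omega> * v i) \<partial>M)"
    proof (rule Bochner_Integration.integral_cong[OF refl])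
      fix \<omega> assume "\<omega> \<in> space M"
      then obtain w where "w \<in> S" "\<omega> \<in> A w" using range by (auto simp: A_def)
      with sum_A[of w \<omega> "\<lambda>v. v i"] that show "g \<omega> i = (\<Sum>v\<in>S. indicator (A v) \<omega> * v i)"
        by (auto simp: A_def)
    qed
    thus ?thesis by (simp only: int_A)
  qed
  hence "on_vec \<rho> n (\<lambda>i. \<integral>\<omega>. g \<omega> i \<partial>M) = on_vec \<rho> n (\<lambda>i. \<Sum>v\<in>S. measure M (A v) * v i)"
    by (rule gauge_cong)
  also have "\<dots> \<le> (\<Sum>v\<in>S. measure M (A v) * on_vec \<rho> n v)"
    using S by (intro gauge_sum) auto
  also have "\<dots> = (\<integral>\<omega>. (\<Sum>v\<in>S. indicator (A v) \<omega> * on_vec \<rho> n v) \<partial>M)" by (simp only: int_A)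
  also have "\<dots> = (\<integral>\<omega>. on_vec \<rho> n (g \<omega>) \<partial>M)"
  proof (rule Bochner_Integration.integral_cong[OF refl])
    fix \<omega> assume "\<omega> \<in> space M"
    then obtain w where w: "w \<in> S" "\<omega> \<in> A w" using range by (auto simp: A_def)
    hence "on_vec \<rho> n (g \<omega>) = on_vec \<rho> n w" by (intro gauge_cong) (auto simp: A_def)
    with sum_A[OF w] show "(\<Sum>v\<in>S. indicator (A v) \<omega> * on_vec \<rho> n v) = on_vec \<rho> n (g \<omega>)" by simp
  qed
  finally show ?thesis .
qed

text \<open>Rounding the bounded \<open>g\<close> down to a grid of width \<open>1 / Suc N\<close>
  makes its range finite. It costs at most \<open>?c / Suc N\<close> on each side of the inequality,
  which vanishes in the limit.\<close>

lemma gauge_jensen: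
  assumes M: "prob_space M"
    and meas: "\<And>i. i < n \<Longrightarrow> (\<lambda>\<omega>. g \<omega> i) \<in> borel_measurable M"
    and bnd: "\<And>\<omega> i. i < n \<Longrightarrow> \<bar>g \<omega> i\<bar> \<le> B"
  shows "on_vec \<rho> n (\<lambda>i. \<integral>\<omega>. g \<omega> i \<partial>M) \<le> (\<integral>\<omega>. on_vec \<rho> n (g \<omega>) \<partial>M)"
proof -
  interpret prob_space M by fact
  \<comment> \<open>A Lipschitz constant of the gauge for the maximum distance.\<close>
  let ?c = "\<Sum>k<n. on_vec \<rho> n (indicator {k})"
  have c0: "?c \<ge> 0" by (intro sum_nonneg gauge_nonneg)
  have step: "on_vec \<rho> n (\<lambda>i. \<integral>\<omega>. g \<omega> i \<partial>M) \<le> (\<integral>\<omega>. on_vec \<rho> n (g \<omega>) \<partial>M) + 2 * ?c / real (Suc N)" for N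
  proof -
    let ?N = "real (Suc N)"
    define q where "q t = real_of_int \<lfloor>?N * t\<rfloor> / ?N" for t :: real
    have q: "\<bar>q t - t\<bar> \<le> 1 / ?N" for t
    proof -
      have "\<bar>real_of_int \<lfloor>?N * t\<rfloor> - ?N * t\<bar> \<le> 1" by linarith
      moreover have "q t - t = (real_of_int \<lfloor>?N * t\<rfloor> - ?N * t) / ?N"
        unfolding q_def by (simp add: diff_divide_distrib del: of_nat_Suc)
      ultimately show ?thesis by (simp add: divide_right_mono del: of_nat_Suc)
    qed
    have qmeas[measurable]: "q \<in> borel_measurable borel" unfolding q_def by measurable
    have lip: "\<bar>on_vec \<rho> n x - on_vec \<rho> n y\<bar> \<le> ?c / ?N" if "\<And>i. i < n \<Longrightarrow> \<bar>x i - y i\<bar> \<le> 1 / ?N" for x y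
    proof -
      have "\<bar>on_vec \<rho> n x - on_vec \<rho> n y\<bar> \<le> (\<Sum>k<n. \<bar>x k - y k\<bar> * on_vec \<rho> n (indicator {k}))"
        by (rule gauge_lipschitz)
      also have "\<dots> \<le> (\<Sum>k<n. 1 / ?N * on_vec \<rho> n (indicator {k}))"
        using that by (intro sum_mono mult_right_mono gauge_nonneg) auto
      finally show ?thesis by (simp add: sum_divide_distrib)
    qed
    define h where "h \<omega> i = q (g \<omega> i)" for \<omega> i
    have hmeas: "(\<lambda>\<omega>. h \<omega> i) \<in> borel_measurable M" if "i < n" for i
      unfolding h_def using meas[OF that] by measurable
    have hbnd: "\<bar>h \<omega> i\<bar> \<le> B + 1 / ?N" if "i < n" for \<omega> i
      using q[of "g \<omega> i"] bnd[OF that, of \<omega>] unfolding h_def by linarith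
    let ?Q = "(\<lambda>z. real_of_int z / ?N) ` {\<lfloor>?N * - B\<rfloor>..\<lfloor>?N * B\<rfloor>}"
    have "h \<omega> i \<in> ?Q" if "i < n" for \<omega> i
    proof -
      have "?N * - B \<le> ?N * g \<omega> i" "?N * g \<omega> i \<le> ?N * B"
        using bnd[OF that, of \<omega>] by (intro mult_left_mono; linarith)+
      hence "\<lfloor>?N * g \<omega> i\<rfloor> \<in> {\<lfloor>?N * - B\<rfloor>..\<lfloor>?N * B\<rfloor>}"
        unfolding atLeastAtMost_iff by (intro conjI floor_mono)
      thus ?thesis unfolding h_def q_def by (rule imageI)
    qed
    hence "on_vec \<rho> n (\<lambda>i. \<integral>\<omega>. h \<omega> i \<partial>M) \<le> (\<integral>\<omega>. on_vec \<rho> n (h \<omega>) \<partial>M)"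
      by (intro gauge_jensen_finite_range[where S = "PiE {..<n} (\<lambda>_. ?Q)"] finite_PiE hmeas)
        (auto intro!: bexI[of _ "restrict (h _) {..<n}"] finite_measure_axioms simp: PiE_def simp del: of_nat_Suc)
    moreover have "\<bar>on_vec \<rho> n (\<lambda>i. \<integral>\<omega>. g \<omega> i \<partial>M) - on_vec \<rho> n (\<lambda>i. \<integral>\<omega>. h \<omega> i \<partial>M)\<bar> \<le> ?c / ?N"
    proof (rule lip)
      fix i assume i: "i < n"
      have ig: "integrable M (\<lambda>\<omega>. g \<omega> i)"
        by (rule integrable_const_bound[where B = B]) (use i meas bnd in auto)
      have ih: "integrable M (\<lambda>\<omega>. h \<omega> i)"
        by (rule integrable_const_bound[where B = "B + 1 / ?N"]) (use i hmeas hbnd in \<open>auto simp del: of_nat_Suc\<close>)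
      have "\<bar>(\<integral>\<omega>. g \<omega> i \<partial>M) - (\<integral>\<omega>. h \<omega> i \<partial>M)\<bar> = \<bar>\<integral>\<omega>. g \<omega> i - h \<omega> i \<partial>M\<bar>"
        using ig ih by simp
      also have "\<dots> \<le> (\<integral>\<omega>. \<bar>g \<omega> i - h \<omega> i\<bar> \<partial>M)" by (rule integral_abs_bound)
      also have "\<dots> \<le> (\<integral>\<omega>. 1 / ?N \<partial>M)"
        using ig ih q by (intro integral_mono) (auto simp: h_def abs_minus_commute simp del: of_nat_Suc)
      finally show "\<bar>(\<integral>\<omega>. g \<omega> i \<partial>M) - (\<integral>\<omega>. h \<omega> i \<partial>M)\<bar> \<le> 1 / ?N" by (simp add: prob_space del: of_nat_Suc)
    qed
    moreover have "(\<integral>\<omega>. on_vec \<rho> n (h \<omega>) \<partial>M) \<le> (\<integral>\<omega>. on_vec \<rho> n (g \<omega>) + ?c / ?N \<partial>M)"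
    proof (rule integral_mono)
      show "integrable M (\<lambda>\<omega>. on_vec \<rho> n (h \<omega>))"
        by (rule gauge_integrable[OF finite_measure_axioms hmeas hbnd])
      show "integrable M (\<lambda>\<omega>. on_vec \<rho> n (g \<omega>) + ?c / ?N)"
        using gauge_integrable[OF finite_measure_axioms meas bnd] by simp
      show "on_vec \<rho> n (h \<omega>) \<le> on_vec \<rho> n (g \<omega>) + ?c / ?N" for \<omega>
        using lip[of "h \<omega>" "g \<omega>"] q by (simp add: h_def abs_le_iff del: of_nat_Suc)
    qed
    moreover have "(\<integral>\<omega>. on_vec \<rho> n (g \<omega>) + ?c / ?N \<partial>M) = (\<integral>\<omega>. on_vec \<rho> n (g \<omega>) \<partial>M) + ?c / ?N"
      using gauge_integrable[OF finite_measure_axioms meas bnd] by (simp add: prob_space)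
    moreover have "2 * ?c / ?N = ?c / ?N + ?c / ?N" by simp
    ultimately show ?thesis by linarith
  qed
  have "(\<lambda>N. (\<integral>\<omega>. on_vec \<rho> n (g \<omega>) \<partial>M) + 2 * ?c / real (Suc N)) \<longlonglongrightarrow> (\<integral>\<omega>. on_vec \<rho> n (g \<omega>) \<partial>M) + 0"
    by (intro tendsto_add tendsto_const LIMSEQ_Suc[OF lim_const_over_n])
  from LIMSEQ_le_const[OF this] step show ?thesis by auto
qed

text \<open>Robin Hood transfers: as long as \<open>x \<le> y\<close> fails, some surplus of \<open>y\<close> over \<open>x\<close> at an index \<open>j\<close>
  can be moved to a later deficit \<open>k\<close>. The new vector is a convex combination of \<open>y\<close> and of \<open>y\<close> with
  the entries \<open>j\<close> and \<open>k\<close> exchanged, and it agrees with \<open>x\<close> at one more index.\<close>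

lemma gauge_dominance:
  assumes "\<And>i j. i \<le> j \<Longrightarrow> j < n \<Longrightarrow> x j \<le> x i"
    and "\<And>i. i < n \<Longrightarrow> 0 \<le> x i" "\<And>i. i < n \<Longrightarrow> 0 \<le> y i"
    and "\<And>k. k \<le> n \<Longrightarrow> (\<Sum>i<k. x i) \<le> (\<Sum>i<k. y i)"
  shows "on_vec \<rho> n x \<le> on_vec \<rho> n y"
  using assms
proof (induction "card {i. i < n \<and> x i \<noteq> y i}" arbitrary: y rule: less_induct)
  case less
  note dec = less.prems(1) and x0 = less.prems(2) and y0 = less.prems(3) and part = less.prems(4)
  show ?case
  proof (cases "\<forall>i<n. x i \<le> y i")
    case True
    thus ?thesis using x0 by (intro gauge_mono) auto
  next
    case False
    define k where "k = (LEAST i. i < n \<and> y i < x i)"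
    have k: "k < n" "y k < x k"
      using LeastI_ex[of "\<lambda>i. i < n \<and> y i < x i"] False unfolding k_def by (auto simp: not_le)
    have kmin: "x i \<le> y i" if "i < k" for i
      using not_less_Least[of i "\<lambda>i. i < n \<and> y i < x i"] that k(1) unfolding k_def[symmetric] by auto
    \<comment> \<open>Without an earlier surplus, the deficit at \<open>k\<close> would violate the
      partial sum inequality of length \<open>Suc k\<close>.\<close>
    have "\<exists>j<k. x j < y j"
    proof (rule ccontr)
      assume "\<not> ?thesis"
      hence "y i \<le> x i" if "i < k" for i using that by (meson not_less)
      hence "(\<Sum>i<k. y i) \<le> (\<Sum>i<k. x i)" by (intro sum_mono) simp
      with part[of "Suc k"] k show False by simp
    qed
    then obtain j0 where j0: "j0 < k \<and> x j0 < y j0" by blast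
    define j where "j = (GREATEST j. j < k \<and> x j < y j)"
    have j: "j < k" "x j < y j"
      using GreatestI_nat[of "\<lambda>j. j < k \<and> x j < y j" j0 k] j0 unfolding j_def by auto
    have jmax: "x i = y i" if "j < i" "i < k" for i
      using Greatest_le_nat[of "\<lambda>j. j < k \<and> x j < y j" i k] kmin[OF that(2)] that
      unfolding j_def[symmetric] by force
    \<comment> \<open>The largest amount that overshoots neither \<open>x j\<close> nor
      \<open>x k\<close>; one of the two is hit exactly.\<close>
    define d where "d = min (y j - x j) (x k - y k)"
    have d: "d > 0" "d \<le> y j - x j" "d \<le> x k - y k" using j k by (auto simp: d_def)
    define z where "z = y(j := y j - d, k := y k + d)"
    have xkj: "x k \<le> x j" using dec[of j k] j k by simp
    have pos: "y j - y k > 0" using xkj j k by linarith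
    \<comment> \<open>Exchanging the entries with weight \<open>t\<close> moves
      \<open>t * (y j - y k) = d\<close> from \<open>j\<close> to \<open>k\<close>. The weight is at
      most 1 because \<open>y k < x k \<le> x j < y j\<close>.\<close>
    define t where "t = d / (y j - y k)"
    have t: "0 \<le> t" "t \<le> 1" using d pos xkj k by (auto simp: t_def)
    have td: "t * y j - t * y k = d"
      unfolding right_diff_distrib[symmetric] using pos by (simp add: t_def)
    have zy: "on_vec \<rho> n z \<le> on_vec \<rho> n y"
    proof (rule gauge_convex[OF t])
      show "on_vec \<rho> n (y(j := y k, k := y j)) = on_vec \<rho> n y"
        using j k by (intro gauge_swap) auto
      show "z i = (1 - t) * y i + t * (y(j := y k, k := y j)) i" for i
        using j td by (auto simp: z_def algebra_simps)
    qed
    have "on_vec \<rho> n x \<le> on_vec \<rho> n z"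
    proof (rule less.hyps)
      have sub: "{i. i < n \<and> x i \<noteq> z i} \<subseteq> {i. i < n \<and> x i \<noteq> y i}"
        using j k by (auto simp: z_def)
      moreover have "\<exists>i\<in>{j, k}. x i = z i"
        using j by (auto simp: z_def d_def min_def)
      hence "{i. i < n \<and> x i \<noteq> z i} \<noteq> {i. i < n \<and> x i \<noteq> y i}"
        using j k by fastforce
      ultimately show "card {i. i < n \<and> x i \<noteq> z i} < card {i. i < n \<and> x i \<noteq> y i}"
        by (intro psubset_card_mono) auto
      show "0 \<le> z i" if "i < n" for i
        using y0[OF that] x0[of j] j k d by (auto simp: z_def)
      have zsum: "(\<Sum>i<l. z i) = (\<Sum>i<l. y i) - (if j < l then d else 0) + (if k < l then d else 0)" for l
      proof -
        have "(\<Sum>i<l. z i) = (\<Sum>i<l. y i + ((if i = j then - d else 0) + (if i = k then d else 0)))"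
          using j by (intro sum.cong) (auto simp: z_def)
        thus ?thesis by (simp add: sum.distrib)
      qed
      \<comment> \<open>Only sums that contain \<open>j\<close> but not \<open>k\<close> change.
        Before \<open>k\<close> no entry of \<open>y\<close> is below that of \<open>x\<close>, and
        the surplus at \<open>j\<close> alone covers the loss \<open>d\<close>.\<close>
      show "(\<Sum>i<l. x i) \<le> (\<Sum>i<l. z i)" if "l \<le> n" for l
      proof (cases "j < l \<and> l \<le> k")
        case True
        have "(\<Sum>i<l. y i - x i) \<ge> (\<Sum>i<l. if i = j then d else 0)"
          using True d kmin by (intro sum_mono) (auto simp: le_diff_eq)
        hence "(\<Sum>i<l. y i) - (\<Sum>i<l. x i) \<ge> d" using True by (simp add: sum_subtractf)
        thus ?thesis using zsum[of l] True by simp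
      next
        case False
        thus ?thesis using zsum[of l] part[OF that] j by auto
      qed
    qed (use dec x0 in auto)
    with zy show ?thesis by linarith
  qed
qed

end

section \<open>T-eigenvalues as bounded measurable vectors, and the norms of
  \<open>f(C)\<close>\<close>

lemma rev_sort_nth_mono:
  "i \<le> j \<Longrightarrow> j < length xs \<Longrightarrow> rev (sort xs) ! j \<le> rev (sort (xs :: 'a :: linorder list)) ! i"
  by (auto simp: rev_nth intro!: sorted_nth_mono)

lemma t_eigvals_decreasing:
  "i \<le> j \<Longrightarrow> j < length (t_eigvals m p C) \<Longrightarrow> t_eigvals m p C ! j \<le> t_eigvals m p C ! i"
  unfolding t_eigvals_def by (rule rev_sort_nth_mono) simp_all

text \<open>For a symmetric tensor the T-singular values are the absolute T-eigenvalues, and the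
  operator norm is the head of their decreasing list.\<close>

lemma t_eigvals_le_opnorm:
  assumes C: "t_symmetric m p C" and k: "k < m * p"
  shows "\<bar>t_eigvals m p C ! k\<bar> \<le> t_opnorm m p (cplx_tensor C)"
proof -
  let ?s = "t_singvals m p (cplx_tensor C)"
  let ?x = "t_eigvals m p C ! k"
  have "?x \<in> set (t_eigvals m p C)" using k by (simp add: length_t_eigvals[OF C])
  hence "\<bar>?x\<bar> \<in># image_mset abs (mset (t_eigvals m p C))" by simp
  hence "\<bar>?x\<bar> \<in> set ?s"
    unfolding mset_t_singvals_cplx_tensor[OF C, symmetric] by simp
  then obtain i where i: "i < length ?s" "\<bar>?x\<bar> = ?s ! i" by (auto simp: in_set_conv_nth)
  have "?s ! i \<le> ?s ! 0"
    using i(1) unfolding t_singvals_def by (intro rev_sort_nth_mono) simp_all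
  also have "?s ! 0 = hd ?s" using i(1) by (intro hd_conv_nth[symmetric]) auto
  finally show ?thesis using i(2) by (simp add: t_opnorm_def)
qed

lemma t_eigvals_measurable:
  fixes D :: "'a \<Rightarrow> rtensor"
  assumes sym: "\<And>\<tau>. t_symmetric m p (D \<tau>)"
    and meas: "\<And>j a b. j < p \<Longrightarrow> a < m \<Longrightarrow> b < m \<Longrightarrow> (\<lambda>\<tau>. D \<tau> j $$ (a, b)) \<in> borel_measurable M"
    and bnd: "\<And>\<tau> i. i < m * p \<Longrightarrow> \<bar>t_eigvals m p (D \<tau>) ! i\<bar> \<le> B"
    and i: "i < m * p"
  shows "(\<lambda>\<tau>. t_eigvals m p (D \<tau>) ! i) \<in> borel_measurable M"
proof (rule measurable_sorted_nth[OF _ bnd _ i])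
  show "t_eigvals m p (D \<tau>) ! j \<le> t_eigvals m p (D \<tau>) ! i" if "i \<le> j" "j < m * p" for \<tau> i j
    using that by (intro t_eigvals_decreasing) (simp_all add: length_t_eigvals[OF sym])
  fix n
  let ?F = "\<lambda>k \<tau>. fourier_block m p (cplx_tensor (D \<tau>)) k"
  have "(\<Sum>i<m * p. t_eigvals m p (D \<tau>) ! i ^ n) = Re (\<Sum>k<p. mat_trace (?F k \<tau> ^\<^sub>m n))" for \<tau>
    unfolding t_eigvals_power_sum[OF sym, symmetric]
    by (simp add: sum_list_sum_nth length_t_eigvals[OF sym] lessThan_atLeast0)
  moreover have "(\<lambda>\<tau>. mat_trace (?F k \<tau> ^\<^sub>m n)) \<in> borel_measurable M" if "k < p" for k
  proof -
    have dim: "dim_row (?F k \<tau> ^\<^sub>m n) = m" for \<tau>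
      using pow_carrier_mat[OF fourier_block_carrier] by blast
    have "(\<lambda>\<tau>. ?F k \<tau> $$ (a, b)) \<in> borel_measurable M" if "a < m" "b < m" for a b
      unfolding fourier_block_cplx_tensor_index[OF sym that] using meas that by measurable
    hence "(\<lambda>\<tau>. (?F k \<tau> ^\<^sub>m n) $$ (a, a)) \<in> borel_measurable M" if "a < m" for a
      using that by (intro measurable_pow_mat[where n = m]) auto
    thus ?thesis unfolding mat_trace_def dim by simp
  qed
  ultimately show "(\<lambda>\<tau>. \<Sum>i<m * p. t_eigvals m p (D \<tau>) ! i ^ n) \<in> borel_measurable M"
    by simp
qed

text \<open>The singular values come in their own sorted order, which permutation invariance of the
  gauge absorbs; \<open>f \<ge> 0\<close> removes the absolute values.\<close>

lemma t_ui_norm_t_fun: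
  assumes C: "t_symmetric m p C" and \<rho>: "sym_gauge (m * p) \<rho>" and f: "\<And>x. f x \<ge> 0"
  shows "t_ui_norm m p \<rho> (t_fun m p f C) = on_vec \<rho> (m * p) (\<lambda>i. f (t_eigvals m p C ! i))"
proof -
  let ?xs = "map f (t_eigvals m p C)"
  have eq: "?xs = map (\<lambda>i. f (t_eigvals m p C ! i)) [0..<m * p]"
    by (rule nth_equalityI) (simp_all add: length_t_eigvals[OF C])
  have "length ?xs = m * p" by (simp add: length_t_eigvals[OF C])
  moreover have "mset ?xs = mset (t_singvals m p (t_fun m p f C))"
    using f by (simp add: mset_t_singvals_t_fun[OF C])
  ultimately have "\<rho> (t_singvals m p (t_fun m p f C)) = \<rho> ?xs" by (rule sym_gaugeD(5)[OF \<rho>])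
  thus ?thesis unfolding t_ui_norm_def eq .
qed

section \<open>Subgradients, Abel summation and weak majorization\<close>

text \<open>The slope taken at \<open>x\<close> is the infimum of the difference quotients towards
  points on the right, that is, the right derivative.\<close>

lemma convex_subgradient:
  fixes f :: "real \<Rightarrow> real"
  assumes "convex_on UNIV f"
  obtains s where "\<And>x y. f y \<ge> f x + s x * (y - x)"
proof
  fix x y :: real
  show "f y \<ge> f x + Inf ((\<lambda>t. (f x - f t) / (x - t)) ` ({x<..} \<inter> UNIV)) * (y - x)"
    by (rule convex_le_Inf_differential[OF assms]) simp_all
qed

text \<open>In the induction, lowering \<open>s l\<close> to \<open>s (Suc l)\<close> in front of a
  nonnegative partial sum only weakens the lower bound. In the end the last weight and the total sum
  are both nonnegative.\<close>

lemma abel_nonneg: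
  fixes s d :: "nat \<Rightarrow> real"
  assumes "\<And>i j. i \<le> j \<Longrightarrow> j < k \<Longrightarrow> s j \<le> s i" "\<And>i. i < k \<Longrightarrow> 0 \<le> s i"
    and "\<And>l. l \<le> k \<Longrightarrow> 0 \<le> (\<Sum>i<l. d i)"
  shows "0 \<le> (\<Sum>i<k. s i * d i)"
proof -
  have "s l * (\<Sum>i<Suc l. d i) \<le> (\<Sum>i<Suc l. s i * d i)" if "l < k" for l
    using that
  proof (induction l)
    case (Suc l)
    have "s (Suc l) * (\<Sum>i<Suc l. d i) \<le> s l * (\<Sum>i<Suc l. d i)"
      using assms(1)[of l "Suc l"] assms(3)[of "Suc l"] Suc.prems by (intro mult_right_mono) auto
    with Suc show ?case by (simp add: distrib_left)
  qed simp
  note claim = this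
  show ?thesis
  proof (cases k)
    case (Suc l)
    have "0 \<le> s l * (\<Sum>i<Suc l. d i)" using assms(2)[of l] assms(3)[of k] Suc by simp
    also have "\<dots> \<le> (\<Sum>i<Suc l. s i * d i)" using Suc by (intro claim) simp
    finally show ?thesis using Suc by simp
  qed simp
qed

text \<open>Eliminates the sorting and adds the empty sum \<open>k = 0\<close>, which is the form
  that Abel summation and the dominance argument work with.\<close>

lemma weak_submaj_decreasing_iff:
  assumes len: "length xs = n" "length ys = n"
    and dec: "\<And>i j. i \<le> j \<Longrightarrow> j < n \<Longrightarrow> xs ! j \<le> xs ! i" "\<And>i j. i \<le> j \<Longrightarrow> j < n \<Longrightarrow> ys ! j \<le> ys ! i"
  shows "weak_submaj xs ys \<longleftrightarrow> (\<forall>k\<le>n. (\<Sum>i<k. xs ! i) \<le> (\<Sum>i<k. ys ! i))"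
proof -
  have sorted: "rev (sort zs) = zs" if "length zs = n" "\<And>i j. i \<le> j \<Longrightarrow> j < n \<Longrightarrow> zs ! j \<le> zs ! i"
    for zs :: "real list"
  proof -
    have "sorted (rev zs)"
      unfolding sorted_iff_nth_mono using that by (simp add: rev_nth)
    hence "sort zs = rev zs" by (intro properties_for_sort) simp_all
    thus ?thesis by simp
  qed
  have take: "sum_list (take k zs) = (\<Sum>i<k. zs ! i)" if "k \<le> length zs" for k and zs :: "real list"
    using that by (auto simp: sum_list_sum_nth lessThan_atLeast0 intro!: sum.cong)
  have "weak_submaj xs ys \<longleftrightarrow> (\<forall>k\<in>{1..n}. (\<Sum>i<k. xs ! i) \<le> (\<Sum>i<k. ys ! i))"
  proof -
    have "rev (sort xs) = xs" by (rule sorted[OF len(1)]) (rule dec(1))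
    moreover have "rev (sort ys) = ys" by (rule sorted[OF len(2)]) (rule dec(2))
    ultimately show ?thesis unfolding weak_submaj_def using len take by auto
  qed
  also have "\<dots> \<longleftrightarrow> (\<forall>k\<le>n. (\<Sum>i<k. xs ! i) \<le> (\<Sum>i<k. ys ! i))"
  proof (intro iffI allI impI ballI)
    fix k assume *: "\<forall>k\<in>{1..n}. (\<Sum>i<k. xs ! i) \<le> (\<Sum>i<k. ys ! i)" and "k \<le> n"
    thus "(\<Sum>i<k. xs ! i) \<le> (\<Sum>i<k. ys ! i)" by (cases "k = 0") simp_all
  qed simp
  finally show ?thesis .
qed

section \<open>Ky Fan norms\<close>

text \<open>The sum of the \<open>k\<close> largest absolute entries, written as a maximum over
  index sets: the gauge axioms then reduce to estimates on one maximising set, without any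
  sorting.\<close>

definition ky_fan :: "nat \<Rightarrow> real list \<Rightarrow> real" where
  "ky_fan k xs = Max ((\<lambda>S. \<Sum>i\<in>S. \<bar>xs ! i\<bar>) ` {S. S \<subseteq> {..<length xs} \<and> card S = k})"

lemma finite_ky_fan_sums: "finite ((\<lambda>S. \<Sum>i\<in>S. \<bar>xs ! i\<bar>) ` {S. S \<subseteq> {..<length xs} \<and> card S = k})"
  by simp

lemma ky_fan_upper:
  "S \<subseteq> {..<length xs} \<Longrightarrow> card S = k \<Longrightarrow> (\<Sum>i\<in>S. \<bar>xs ! i\<bar>) \<le> ky_fan k xs"
  unfolding ky_fan_def by (intro Max_ge finite_ky_fan_sums imageI) simp

lemma ky_fan_attained:
  assumes "k \<le> length xs"
  obtains S where "S \<subseteq> {..<length xs}" "card S = k" "ky_fan k xs = (\<Sum>i\<in>S. \<bar>xs ! i\<bar>)"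
proof -
  have "{..<k} \<in> {S. S \<subseteq> {..<length xs} \<and> card S = k}" using assms by auto
  hence "(\<lambda>S. \<Sum>i\<in>S. \<bar>xs ! i\<bar>) ` {S. S \<subseteq> {..<length xs} \<and> card S = k} \<noteq> {}" by blast
  from Max_in[OF finite_ky_fan_sums this] that show ?thesis unfolding ky_fan_def by auto
qed

lemma ky_fan_perm_le:
  assumes "k \<le> length xs" "mset xs = mset ys"
  shows "ky_fan k xs \<le> ky_fan k ys"
proof -
  from mset_eq_permutation[OF assms(2)] obtain \<pi>
    where \<pi>: "\<pi> permutes {..<length ys}" "permute_list \<pi> ys = xs" .
  have len: "length xs = length ys" using assms(2) by (rule mset_eq_length)
  obtain S where S: "S \<subseteq> {..<length xs}" "card S = k" "ky_fan k xs = (\<Sum>i\<in>S. \<bar>xs ! i\<bar>)"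
    using ky_fan_attained[OF assms(1)] .
  have inj: "inj_on \<pi> S" using \<pi>(1) by (meson inj_on_subset permutes_inj subset_UNIV)
  have "(\<Sum>i\<in>S. \<bar>xs ! i\<bar>) = (\<Sum>i\<in>S. \<bar>ys ! \<pi> i\<bar>)"
    using S(1) \<pi> len by (intro sum.cong refl) (auto simp: permute_list_nth[OF \<pi>(1), symmetric])
  also have "\<dots> = (\<Sum>i\<in>\<pi> ` S. \<bar>ys ! i\<bar>)" by (simp add: sum.reindex[OF inj])
  also have "\<dots> \<le> ky_fan k ys"
    using S len permutes_image[OF \<pi>(1)] card_image[OF inj] by (intro ky_fan_upper) auto
  finally show ?thesis using S(3) by simp
qed

text \<open>Definiteness rests on \<open>1 \<le> k\<close>, by which every index belongs to some set
  of size \<open>k\<close>; \<open>k \<le> n\<close> makes the family of sets nonempty, so that the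
  maximum is attained.\<close>

lemma sym_gauge_ky_fan:
  assumes k: "1 \<le> k" "k \<le> n"
  shows "sym_gauge n (ky_fan k)"
  unfolding sym_gauge_def
proof (intro conjI allI impI)
  fix x y :: "real list" and c :: real assume len: "length x = n"
  have att: "\<exists>S. S \<subseteq> {..<n} \<and> card S = k \<and> ky_fan k z = (\<Sum>i\<in>S. \<bar>z ! i\<bar>)" if "length z = n" for z
    using ky_fan_attained[of k z] k that by metis
  show nonneg: "ky_fan k x \<ge> 0" using att[OF len] by (auto simp: sum_nonneg)
  show "ky_fan k x = 0 \<longleftrightarrow> x = replicate n 0"
  proof
    assume 0: "ky_fan k x = 0"
    have "x ! i = 0" if i: "i < n" for i
    proof -
      obtain T where T: "T \<subseteq> {..<n} - {i}" "card T = k - 1"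
      proof -
        have "k - 1 \<le> card ({..<n} - {i})" using i k by auto
        from obtain_subset_with_card_n[OF this] that show ?thesis by metis
      qed
      have fin: "finite T" using T(1) by (rule finite_subset) simp
      have "card (insert i T) = k" using T k fin by (subst card_insert_disjoint) auto
      with T i len have "(\<Sum>j\<in>insert i T. \<bar>x ! j\<bar>) \<le> ky_fan k x"
        by (intro ky_fan_upper) auto
      moreover have "\<bar>x ! i\<bar> \<le> (\<Sum>j\<in>insert i T. \<bar>x ! j\<bar>)"
        using fin by (intro member_le_sum) auto
      ultimately show ?thesis using 0 by simp
    qed
    thus "x = replicate n 0" using len by (intro nth_equalityI) auto
  next
    assume "x = replicate n 0"
    with att[OF len] show "ky_fan k x = 0" by (force intro!: sum.neutral)
  qed
  show "ky_fan k (map (\<lambda>t. c * t) x) = \<bar>c\<bar> * ky_fan k x"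
  proof -
    have eq: "(\<Sum>i\<in>S. \<bar>map (\<lambda>t. c * t) x ! i\<bar>) = \<bar>c\<bar> * (\<Sum>i\<in>S. \<bar>x ! i\<bar>)" if "S \<subseteq> {..<n}" for S
      unfolding sum_distrib_left using that len by (intro sum.cong) (auto simp: abs_mult)
    obtain S where S: "S \<subseteq> {..<n}" "card S = k" "ky_fan k x = (\<Sum>i\<in>S. \<bar>x ! i\<bar>)"
      using att[OF len] by blast
    obtain T where T: "T \<subseteq> {..<n}" "card T = k"
      "ky_fan k (map (\<lambda>t. c * t) x) = (\<Sum>i\<in>T. \<bar>map (\<lambda>t. c * t) x ! i\<bar>)"
      using att[of "map (\<lambda>t. c * t) x"] len by auto
    have "\<bar>c\<bar> * ky_fan k x \<le> ky_fan k (map (\<lambda>t. c * t) x)"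
      using ky_fan_upper[of S "map (\<lambda>t. c * t) x" k] S len eq[OF S(1)] by simp
    moreover have "ky_fan k (map (\<lambda>t. c * t) x) \<le> \<bar>c\<bar> * ky_fan k x"
      unfolding T(3) eq[OF T(1)] using ky_fan_upper[of T x k] T len by (intro mult_left_mono) auto
    ultimately show ?thesis by simp
  qed
  show "ky_fan k (map abs x) = ky_fan k x"
    unfolding ky_fan_def length_map
    by (intro arg_cong[of _ _ Max] image_cong refl sum.cong) auto
  show "ky_fan k (map2 (+) x y) \<le> ky_fan k x + ky_fan k y" if "length y = n"
  proof -
    have lenz: "length (map2 (+) x y) = n" using len that by simp
    obtain S where S: "S \<subseteq> {..<n}" "card S = k"
      "ky_fan k (map2 (+) x y) = (\<Sum>i\<in>S. \<bar>map2 (+) x y ! i\<bar>)"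
      using att[OF lenz] by blast
    have "(\<Sum>i\<in>S. \<bar>map2 (+) x y ! i\<bar>) \<le> (\<Sum>i\<in>S. \<bar>x ! i\<bar> + \<bar>y ! i\<bar>)"
      using S(1) len that by (intro sum_mono) (auto simp: abs_triangle_ineq)
    also have "\<dots> \<le> ky_fan k x + ky_fan k y"
      unfolding sum.distrib using S len that by (intro add_mono ky_fan_upper) auto
    finally show ?thesis using S(3) by simp
  qed
  show "ky_fan k y = ky_fan k x" if "mset x = mset y"
  proof (rule antisym)
    have "length y = n" using mset_eq_length[OF that] len by simp
    thus "ky_fan k y \<le> ky_fan k x" using k that by (intro ky_fan_perm_le) simp_all
    show "ky_fan k x \<le> ky_fan k y" using k that len by (intro ky_fan_perm_le) simp_all
  qed
qed

text \<open>For the upper bound, every entry is at most a threshold \<open>t\<close> plus its excess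
  over \<open>t\<close>. With the \<open>k\<close>-th largest entry as threshold, the excess
  vanishes from index \<open>k\<close> on.\<close>

lemma ky_fan_decreasing:
  assumes k: "k \<le> n"
    and dec: "\<And>i j. i \<le> j \<Longrightarrow> j < n \<Longrightarrow> x j \<le> x i" and nonneg: "\<And>i. i < n \<Longrightarrow> 0 \<le> x i"
  shows "on_vec (ky_fan k) n x = (\<Sum>i<k. x i)"
proof (rule antisym)
  have val: "(\<Sum>i\<in>S. \<bar>map x [0..<n] ! i\<bar>) = (\<Sum>i\<in>S. x i)" if "S \<subseteq> {..<n}" for S
    using that nonneg by (intro sum.cong) auto
  have "(\<Sum>i\<in>{..<k}. \<bar>map x [0..<n] ! i\<bar>) \<le> on_vec (ky_fan k) n x"
    using k by (intro ky_fan_upper) auto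
  thus "(\<Sum>i<k. x i) \<le> on_vec (ky_fan k) n x" using val[of "{..<k}"] k by auto
  have kn: "k \<le> length (map x [0..<n])" using k by simp
  obtain S where S': "S \<subseteq> {..<length (map x [0..<n])}" and card_S: "card S = k"
    and eq: "on_vec (ky_fan k) n x = (\<Sum>i\<in>S. \<bar>map x [0..<n] ! i\<bar>)"
    using ky_fan_attained[OF kn] .
  have S: "S \<subseteq> {..<n}" "card S = k" using S' card_S by simp_all
  \<comment> \<open>Entries count from 0, hence \<open>k - 1\<close>; for \<open>k = 0\<close>
    truncated subtraction gives \<open>x 0\<close>, over which no entry has an excess.\<close>
  define t where "t = x (k - 1)"
  have "(\<Sum>i\<in>S. x i) \<le> (\<Sum>i\<in>S. t + max 0 (x i - t))" by (intro sum_mono) auto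
  also have "\<dots> = real k * t + (\<Sum>i\<in>S. max 0 (x i - t))" using S by (simp add: sum.distrib)
  also have "(\<Sum>i\<in>S. max 0 (x i - t)) \<le> (\<Sum>i<n. max 0 (x i - t))"
    using S by (intro sum_mono2) auto
  also have "\<dots> = (\<Sum>i<k. max 0 (x i - t))"
    using k dec by (intro sum.mono_neutral_right) (auto simp: t_def)
  also have "\<dots> = (\<Sum>i<k. x i - t)"
    using k dec by (intro sum.cong) (auto simp: t_def)
  finally show "on_vec (ky_fan k) n x \<le> (\<Sum>i<k. x i)"
    unfolding eq val[OF S(1)] by (simp add: sum_subtractf)
qed

lemma convex_on_pos_part: "convex_on UNIV (\<lambda>t :: real. max (t + c) 0)"
proof (rule convex_onI)
  fix t x y :: real assume t: "0 < t" "t < 1"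
  have "(1 - t) * (x + c) \<le> (1 - t) * max (x + c) 0" "t * (y + c) \<le> t * max (y + c) 0"
    "0 \<le> (1 - t) * max (x + c) 0" "0 \<le> t * max (y + c) 0"
    using t by (auto intro!: mult_left_mono)
  moreover have "(1 - t) *\<^sub>R x + t *\<^sub>R y + c = (1 - t) * (x + c) + t * (y + c)"
    by (simp add: algebra_simps)
  ultimately show "max ((1 - t) *\<^sub>R x + t *\<^sub>R y + c) 0 \<le> (1 - t) * max (x + c) 0 + t * max (y + c) 0"
    by linarith
qed simp

section \<open>Weak majorization of T-eigenvalues against integrated norm inequalities\<close>

theorem mainTheorem4:
  fixes m p :: nat
    and \<nu> :: "'a::metric_space measure"
    and C :: rtensor
    and D :: "'a \<Rightarrow> rtensor"
  assumes "sigma_compact (UNIV :: 'a set)"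
    and "prob_space \<nu>" and "sets \<nu> = sets borel"
    and "t_symmetric m p C"
    and "\<forall>\<tau>. t_symmetric m p (D \<tau>)"
    and "\<forall>j<p. \<forall>a<m. \<forall>b<m. continuous_on UNIV (\<lambda>\<tau>. D \<tau> j $$ (a, b))"
    and "\<exists>B. \<forall>\<tau>. t_opnorm m p (cplx_tensor (D \<tau>)) \<le> B"
  shows "weak_submaj (t_eigvals m p C)
           (map (\<lambda>i. \<integral>\<tau>. t_eigvals m p (D \<tau>) ! i \<partial>\<nu>) [0..<m * p])
         \<longleftrightarrow>
         (\<forall>f \<rho>. mono f \<longrightarrow> convex_on UNIV f \<longrightarrow> (\<forall>x. f x \<ge> 0) \<longrightarrow> sym_gauge (m * p) \<rho> \<longrightarrow>
            t_ui_norm m p \<rho> (t_fun m p f C)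
              \<le> (\<integral>\<tau>. t_ui_norm m p \<rho> (t_fun m p f (D \<tau>)) \<partial>\<nu>))"
proof -
  interpret prob_space \<nu> by fact
  note C = assms(4)
  have D: "t_symmetric m p (D \<tau>)" for \<tau> using assms(5) by blast
  let ?n = "m * p"
  define x where "x i = t_eigvals m p C ! i" for i
  define Y where "Y \<tau> i = t_eigvals m p (D \<tau>) ! i" for \<tau> i
  define y where "y i = (\<integral>\<tau>. Y \<tau> i \<partial>\<nu>)" for i
  obtain B where B: "\<And>\<tau>. t_opnorm m p (cplx_tensor (D \<tau>)) \<le> B" using assms(7) by blast
  have Y_bnd: "\<bar>Y \<tau> i\<bar> \<le> B" if "i < ?n" for \<tau> i
    using order_trans[OF t_eigvals_le_opnorm[OF D that] B] by (simp add: Y_def)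
  have Y_meas: "(\<lambda>\<tau>. Y \<tau> i) \<in> borel_measurable \<nu>" if "i < ?n" for i
    unfolding Y_def
  proof (rule t_eigvals_measurable[OF D])
    show "(\<lambda>\<tau>. D \<tau> j $$ (a, b)) \<in> borel_measurable \<nu>" if "j < p" "a < m" "b < m" for j a b
    proof -
      have "(\<lambda>\<tau>. D \<tau> j $$ (a, b)) \<in> borel_measurable borel"
        using assms(6) that by (intro borel_measurable_continuous_onI) simp
      thus ?thesis by (simp cong: measurable_cong_sets add: assms(3))
    qed
  qed (use Y_bnd that in \<open>auto simp: Y_def\<close>)
  have Y_int: "integrable \<nu> (\<lambda>\<tau>. Y \<tau> i)" if "i < ?n" for i
    by (rule integrable_const_bound[where B = B]) (use Y_bnd Y_meas that in auto)
  have x_dec: "x j \<le> x i" if "i \<le> j" "j < ?n" for i j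
    unfolding x_def using that by (intro t_eigvals_decreasing) (simp_all add: length_t_eigvals[OF C])
  have Y_dec: "Y \<tau> j \<le> Y \<tau> i" if "i \<le> j" "j < ?n" for \<tau> i j
    unfolding Y_def using that by (intro t_eigvals_decreasing) (simp_all add: length_t_eigvals[OF D])
  \<comment> \<open>Integration preserves the order of the coordinates, so the integrated vector is
    already sorted.\<close>
  have y_dec: "y j \<le> y i" if "i \<le> j" "j < ?n" for i j
    unfolding y_def using that Y_dec Y_int by (intro integral_mono) auto
  have maj: "weak_submaj (t_eigvals m p C) (map (\<lambda>i. \<integral>\<tau>. t_eigvals m p (D \<tau>) ! i \<partial>\<nu>) [0..<?n]) \<longleftrightarrow>
    (\<forall>k\<le>?n. (\<Sum>i<k. x i) \<le> (\<Sum>i<k. y i))"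
  proof (subst weak_submaj_decreasing_iff[of _ ?n])
    let ?ys = "map (\<lambda>i. \<integral>\<tau>. t_eigvals m p (D \<tau>) ! i \<partial>\<nu>) [0..<?n]"
    have ys: "?ys ! i = y i" if "i < ?n" for i using that by (simp add: y_def Y_def)
    show "length (t_eigvals m p C) = ?n" by (rule length_t_eigvals[OF C])
    show "t_eigvals m p C ! j \<le> t_eigvals m p C ! i" if "i \<le> j" "j < ?n" for i j
      using x_dec[OF that] by (simp add: x_def)
    show "?ys ! j \<le> ?ys ! i" if "i \<le> j" "j < ?n" for i j
      using y_dec[OF that] ys[of i] ys[of j] that by simp
    have "(\<Sum>i<k. ?ys ! i) = (\<Sum>i<k. y i)" if "k \<le> ?n" for k
      using that ys by (intro sum.cong) auto
    thus "(\<forall>k\<le>?n. (\<Sum>i<k. t_eigvals m p C ! i) \<le> (\<Sum>i<k. ?ys ! i)) \<longleftrightarrow>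
      (\<forall>k\<le>?n. (\<Sum>i<k. x i) \<le> (\<Sum>i<k. y i))" by (simp add: x_def)
  qed simp
  have norm_C: "t_ui_norm m p \<rho> (t_fun m p f C) = on_vec \<rho> ?n (\<lambda>i. f (x i))"
    if "sym_gauge ?n \<rho>" "\<forall>t. f t \<ge> 0" for \<rho> f
    using t_ui_norm_t_fun[OF C that(1), of f] that(2) by (simp add: x_def)
  have norm_D: "t_ui_norm m p \<rho> (t_fun m p f (D \<tau>)) = on_vec \<rho> ?n (\<lambda>i. f (Y \<tau> i))"
    if "sym_gauge ?n \<rho>" "\<forall>t. f t \<ge> 0" for \<rho> f \<tau>
    using t_ui_norm_t_fun[OF D that(1), of f] that(2) by (simp add: Y_def)
  show ?thesis
    unfolding maj
  proof (intro iffI allI impI)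
    fix f :: "real \<Rightarrow> real" and \<rho>
    assume part: "\<forall>k\<le>?n. (\<Sum>i<k. x i) \<le> (\<Sum>i<k. y i)"
      and mono: "mono f" and conv: "convex_on UNIV f" and f0: "\<forall>t. f t \<ge> 0" and \<rho>: "sym_gauge ?n \<rho>"
    obtain s where s: "\<And>u v. f v \<ge> f u + s u * (v - u)" using convex_subgradient[OF conv] by blast
    \<comment> \<open>Testing at \<open>u - 1\<close> gives
      \<open>s u \<ge> f u - f (u - 1)\<close>.\<close>
    have s0: "s u \<ge> 0" for u
      using s[of u "u - 1"] monoD[OF mono, of "u - 1" u] by simp
    have s_mono: "s u \<le> s v" if "u \<le> v" for u v
    proof (cases "u = v")
      case False
      \<comment> \<open>The sum of the subgradient inequalities at \<open>u\<close> and at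
        \<open>v\<close>.\<close>
      have "(s v - s u) * (v - u) \<ge> 0" using s[of u v] s[of v u] by (simp add: algebra_simps)
      with False that show ?thesis by (simp add: zero_le_mult_iff)
    qed simp
    have fY_bnd: "\<bar>f (Y \<tau> i)\<bar> \<le> f B" if "i < ?n" for \<tau> i
      using Y_bnd[OF that, of \<tau>] f0 by (simp add: monoD[OF mono])
    have fY_meas: "(\<lambda>\<tau>. f (Y \<tau> i)) \<in> borel_measurable \<nu>" if "i < ?n" for i
      using measurable_compose[OF Y_meas[OF that] borel_measurable_mono[OF mono]] .
    have fY_int: "integrable \<nu> (\<lambda>\<tau>. f (Y \<tau> i))" if "i < ?n" for i
      by (rule integrable_const_bound[where B = "f B"]) (use fY_bnd fY_meas that in auto)
    define z where "z i = (\<integral>\<tau>. f (Y \<tau> i) \<partial>\<nu>)" for i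
    \<comment> \<open>The supporting line at \<open>x i\<close> is affine, so integrating it against
      a probability measure replaces \<open>Y \<tau> i\<close> by \<open>y i\<close>.\<close>
    have z: "f (x i) + s (x i) * (y i - x i) \<le> z i" if i: "i < ?n" for i
    proof -
      have "f (x i) + s (x i) * (y i - x i) = (\<integral>\<tau>. f (x i) + s (x i) * (Y \<tau> i - x i) \<partial>\<nu>)"
        using Y_int[OF i] by (simp add: y_def prob_space)
      also have "\<dots> \<le> z i"
        unfolding z_def using s Y_int[OF i] fY_int[OF i] by (intro integral_mono) auto
      finally show ?thesis .
    qed
    have "on_vec \<rho> ?n (\<lambda>i. f (x i)) \<le> on_vec \<rho> ?n z"
    proof (rule gauge_dominance[OF \<rho>])
      show "f (x j) \<le> f (x i)" if "i \<le> j" "j < ?n" for i j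
        by (rule monoD[OF mono x_dec[OF that]])
      show "0 \<le> z i" for i unfolding z_def using f0 by (intro integral_nonneg_AE) auto
      show "(\<Sum>i<k. f (x i)) \<le> (\<Sum>i<k. z i)" if "k \<le> ?n" for k
      proof -
        \<comment> \<open>Majorization enters here: it says that the partial sums of
          \<open>y i - x i\<close> are nonnegative.\<close>
        have "0 \<le> (\<Sum>i<k. s (x i) * (y i - x i))"
        proof (rule abel_nonneg)
          show "0 \<le> (\<Sum>i<l. y i - x i)" if "l \<le> k" for l
            using part \<open>k \<le> ?n\<close> that by (simp add: sum_subtractf)
        qed (use x_dec s_mono s0 that in auto)
        hence "(\<Sum>i<k. f (x i)) \<le> (\<Sum>i<k. f (x i) + s (x i) * (y i - x i))"
          by (simp add: sum.distrib)
        also have "\<dots> \<le> (\<Sum>i<k. z i)" using z that by (intro sum_mono) auto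
        finally show ?thesis .
      qed
    qed (use f0 in auto)
    also have "\<dots> \<le> (\<integral>\<tau>. on_vec \<rho> ?n (\<lambda>i. f (Y \<tau> i)) \<partial>\<nu>)"
      unfolding z_def by (rule gauge_jensen[OF \<rho> prob_space_axioms fY_meas fY_bnd])
    finally show "t_ui_norm m p \<rho> (t_fun m p f C) \<le> (\<integral>\<tau>. t_ui_norm m p \<rho> (t_fun m p f (D \<tau>)) \<partial>\<nu>)"
      unfolding norm_C[OF \<rho> f0] norm_D[OF \<rho> f0] .
  next
    fix k
    assume dom: "\<forall>f \<rho>. mono f \<longrightarrow> convex_on UNIV f \<longrightarrow> (\<forall>t. f t \<ge> 0) \<longrightarrow> sym_gauge ?n \<rho> \<longrightarrow>
      t_ui_norm m p \<rho> (t_fun m p f C) \<le> (\<integral>\<tau>. t_ui_norm m p \<rho> (t_fun m p f (D \<tau>)) \<partial>\<nu>)"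
      and k: "k \<le> ?n"
    show "(\<Sum>i<k. x i) \<le> (\<Sum>i<k. y i)"
    proof (cases "k = 0")
      case False
      \<comment> \<open>For a large shift \<open>c\<close> the function \<open>f t = max (t + c) 0\<close> is \<open>t + c\<close> on all eigenvalues, so the
        Ky Fan norm of \<open>f\<close> is the partial eigenvalue sum up to the constant \<open>k * c\<close>.\<close>
      define c where "c = max B (t_opnorm m p (cplx_tensor C))"
      define f where "f t = max (t + c) 0" for t :: real
      have \<rho>: "sym_gauge ?n (ky_fan k)" using False k by (intro sym_gauge_ky_fan) auto
      have f: "mono f" "convex_on UNIV f" "\<forall>t. f t \<ge> 0"
        unfolding f_def by (auto intro!: monoI convex_on_pos_part)
      have fx: "f (x i) = x i + c" if "i < ?n" for i
        using t_eigvals_le_opnorm[OF C that] by (auto simp: f_def x_def c_def)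
      have fY: "f (Y \<tau> i) = Y \<tau> i + c" if "i < ?n" for \<tau> i
        using Y_bnd[OF that, of \<tau>] by (simp add: f_def c_def)
      have "on_vec (ky_fan k) ?n (\<lambda>i. f (x i)) = (\<Sum>i<k. f (x i))"
        using f(3) by (intro ky_fan_decreasing[OF k] monoD[OF f(1)] x_dec) auto
      also have "\<dots> = (\<Sum>i<k. x i + c)" using fx k by (intro sum.cong) auto
      finally have lhs: "on_vec (ky_fan k) ?n (\<lambda>i. f (x i)) = (\<Sum>i<k. x i) + k * c"
        by (simp add: sum.distrib)
      have rhs: "on_vec (ky_fan k) ?n (\<lambda>i. f (Y \<tau> i)) = (\<Sum>i<k. Y \<tau> i + c)" for \<tau>
      proof -
        have "on_vec (ky_fan k) ?n (\<lambda>i. f (Y \<tau> i)) = (\<Sum>i<k. f (Y \<tau> i))"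
          using f(3) by (intro ky_fan_decreasing[OF k] monoD[OF f(1)] Y_dec) auto
        also have "\<dots> = (\<Sum>i<k. Y \<tau> i + c)" using fY k by (intro sum.cong) auto
        finally show ?thesis .
      qed
      \<comment> \<open>As \<open>\<nu>\<close> has mass 1, the shift contributes
        \<open>k * c\<close> here just as it does for \<open>C\<close>, and cancels.\<close>
      have "(\<integral>\<tau>. (\<Sum>i<k. Y \<tau> i + c) \<partial>\<nu>) = (\<Sum>i<k. \<integral>\<tau>. Y \<tau> i + c \<partial>\<nu>)"
        using Y_int k by (intro Bochner_Integration.integral_sum) auto
      also have "\<dots> = (\<Sum>i<k. y i + c)"
        using Y_int k by (intro sum.cong) (auto simp: y_def prob_space)
      finally have "(\<integral>\<tau>. (\<Sum>i<k. Y \<tau> i + c) \<partial>\<nu>) = (\<Sum>i<k. y i) + k * c"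
        by (simp add: sum.distrib)
      moreover have "(\<Sum>i<k. x i) + k * c \<le> (\<integral>\<tau>. (\<Sum>i<k. Y \<tau> i + c) \<partial>\<nu>)"
      proof -
        have "t_ui_norm m p (ky_fan k) (t_fun m p f C) \<le>
          (\<integral>\<tau>. t_ui_norm m p (ky_fan k) (t_fun m p f (D \<tau>)) \<partial>\<nu>)"
          using dom f \<rho> by blast
        thus ?thesis unfolding norm_C[OF \<rho> f(3)] norm_D[OF \<rho> f(3)] lhs rhs .
      qed
      ultimately show ?thesis by simp
    qed simp
  qed
qed

end
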